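(* Let $T=(T_1,\ldots,T_k)\in B(\mathcal H)^{n_1}\times\cdots\times B(\mathcal H)^{n_k}$. Then $T$ is a pure element in $\mathbf B_\Lambda(\mathcal H)$ if and only if there is a Hilbert space $\mathcal D$ such that $\mathcal H$ can be identified with a co-invariant subspace under the shifts $S_{i,s}\otimes I_{\mathcal D}$ and $$T_{i,s}^*=(S_{i,s}^*\otimes I_{\mathcal D})|_{\mathcal H}$$ for any $i\in\{1,\ldots,k\}$ and $s\in\{1,\ldots,n_i\}$. Moreover, in this case $T\in\mathbf B_\Lambda^d(\mathcal H)$ if and only if, in addition, the relation $$P_{\mathcal H}(S_{i,s}^*\otimes I_{\mathcal D})|_{\mathcal H}\,P_{\mathcal H}(S_{j,t}\otimes I_{\mathcal D})|_{\mathcal H}=P_{\mathcal H}(S_{i,s}^*\otimes I_{\mathcal D})(S_{j,t}\otimes I_{\mathcal D})|_{\mathcal H}$$ holds for any $i,j\in\{1,\ldots,k\}$ with $i\ne j$ and $s\in\{1,\ldots,n_i\}$, $t\in\{1,\ldots,n_j\}$.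
   Context: Fix integers $k\ge1$, $n_1,\ldots,n_k\ge 1$ and, for $i\ne j$ in $\{1,\ldots,k\}$, an $n_i\times n_j$ matrix $\Lambda_{i,j}=[\lambda_{i,j}(s,t)]$ with entries in $\mathbb T=\{z\in\mathbb C:|z|=1\}$, such that $\lambda_{j,i}(t,s)=\overline{\lambda_{i,j}(s,t)}$. $T=(T_1,\ldots,T_k)$ with $T_i=[T_{i,1}\cdots T_{i,n_i}]$, $T_{i,s}\in B(\mathcal H)$, is a $k$-tuple of $\Lambda$-commuting row contractions if $\sum_sT_{i,s}T_{i,s}^*\le I$ for each $i$ and $T_{i,s}T_{j,t}=\lambda_{i,j}(s,t)T_{j,t}T_{i,s}$ for all $i\ne j$, $s,t$. It is doubly $\Lambda$-commuting if, in addition, $T_{i,s}^*T_{j,t}=\overline{\lambda_{i,j}(s,t)}T_{j,t}T_{i,s}^*$ for all $i\neq j$, $s,t$; $\mathbf B^d_\Lambda(\mathcal H)$ is the set of all $k$-tuples of doubly $\Lambda$-commuting row contractions. Let $\Phi_{rT_i}(X):=\sum_{s=1}^{n_i}r^2T_{i,s}XT_{i,s}^*$, $X\in B(\mathcal H)$. The regular $\Lambda$-polyball $\mathbf B_\Lambda(\mathcal H)$ is the set of $k$-tuples of $\Lambda$-commuting row contractions with $(id-\Phi_{rT_1})\circ\cdots\circ(id-\Phi_{rT_k})(I)\ge0$ for all $r\in[0,1)$. $T$ is pure if $\Phi_{T_i}^m(I)\to0$ strongly as $m\to\infty$ for each $i$. $\mathbb F_{n_i}^+$ is the unital free semigroup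 with generators $g_1^i,\ldots,g_{n_i}^i$ and neutral element $g_0^i$. The standard $k$-tuple $S=(S_1,\ldots,S_k)$, $S_i=[S_{i,1}\cdots S_{i,n_i}]$, acts on $\ell^2(\mathbb F_{n_1}^+\times\cdots\times\mathbb F_{n_k}^+)$ with standard basis $\chi_{(\alpha_1,\ldots,\alpha_k)}$ by $$S_{i,s}\chi_{(\alpha_1,\ldots,\alpha_k)}=\boldsymbol\lambda_{i,1}(s,\alpha_1)\cdots\boldsymbol\lambda_{i,i-1}(s,\alpha_{i-1})\chi_{(\alpha_1,\ldots,\alpha_{i-1},g_s^i\alpha_i,\alpha_{i+1},\ldots,\alpha_k)},$$ where $\boldsymbol\lambda_{i,j}(s,g^j_{j_1}\cdots g^j_{j_q})=\prod_{b=1}^q\lambda_{i,j}(s,j_b)$, $\boldsymbol\lambda_{i,j}(s,g_0^j)=1$ (no factor if $i=1$). Co-invariant means invariant under the adjoints. "Identified" means via an isometry $\mathcal H\to\ell^2(\mathbb F_{n_1}^+\times\cdots\times\mathbb F_{n_k}^+)\otimes\mathcal D$ with co-invariant range; after the identification $\mathcal H$ is a closed subspace and $P_{\mathcal H}$ is the orthogonal projection onto it. *)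

theory Defs
  imports "HOL-Analysis.Analysis"
begin

section \<open>Complex Hilbert spaces\<close>

text \<open>
  A complex Hilbert space is a complete real inner product space with a compatible complex scalar
  multiplication and a sesquilinear form \<open>cinner\<close>, linear in the first argument, whose real part is
  the real inner product.  In particular \<open>norm x ^ 2 = cinner x x\<close>.
\<close>

class chilbert_space = real_inner + complete_space +
  fixes scaleC :: "complex \<Rightarrow> 'a \<Rightarrow> 'a"  (infixr \<open>*\<^sub>C\<close> 75)
    and cinner :: "'a \<Rightarrow> 'a \<Rightarrow> complex"
  assumes scaleC_add_right: "c *\<^sub>C (x + y) = c *\<^sub>C x + c *\<^sub>C y"
    and scaleC_add_left: "(c + d) *\<^sub>C x = c *\<^sub>C x + d *\<^sub>C x"
    and scaleC_scaleC: "c *\<^sub>C d *\<^sub>C x = (c * d) *\<^sub>C x"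
    and scaleR_scaleC: "scaleR r x = complex_of_real r *\<^sub>C x"
    and cinner_commute: "cinner x y = cnj (cinner y x)"
    and cinner_add_left: "cinner (x + y) z = cinner x z + cinner y z"
    and cinner_scaleC_left: "cinner (c *\<^sub>C x) y = c * cinner x y"
    and inner_eq_Re_cinner: "inner x y = Re (cinner x y)"

instantiation complex :: chilbert_space
begin

definition scaleC_complex :: "complex \<Rightarrow> complex \<Rightarrow> complex"
  where "scaleC_complex c z = c * z"

definition cinner_complex :: "complex \<Rightarrow> complex \<Rightarrow> complex"
  where "cinner_complex z w = z * cnj w"

instance
  by standard (auto simp: scaleC_complex_def cinner_complex_def algebra_simps inner_complex_def
      scaleR_conv_of_real)

end

lemma scaleC_one [simp]: "1 *\<^sub>C x = (x :: 'a::chilbert_space)"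
  using scaleR_scaleC[of 1 x] by simp

lemma scaleC_zero_left [simp]: "0 *\<^sub>C x = (0 :: 'a::chilbert_space)"
  using scaleR_scaleC[of 0 x] by simp

lemma scaleC_zero_right [simp]: "c *\<^sub>C 0 = (0 :: 'a::chilbert_space)"
  using scaleC_add_right[of c 0 0] by simp

lemma cinner_add_right: "cinner x (y + z) = cinner x y + cinner x (z :: 'a::chilbert_space)"
  by (metis cinner_add_left cinner_commute complex_cnj_add)

lemma cinner_scaleC_right: "cinner x (c *\<^sub>C y) = cnj c * cinner x (y :: 'a::chilbert_space)"
  by (metis cinner_commute cinner_scaleC_left complex_cnj_mult)

lemma cinner_self: "cinner x x = complex_of_real ((norm (x :: 'a::chilbert_space))\<^sup>2)"
proof -
  have "Im (cinner x x) = 0"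
    using cinner_commute[of x x] by (simp add: complex_eq_iff)
  moreover have "Re (cinner x x) = (norm x)\<^sup>2"
    by (metis inner_eq_Re_cinner power2_norm_eq_inner)
  ultimately show ?thesis
    by (simp add: complex_eq_iff)
qed

lemma norm_scaleC: "norm (c *\<^sub>C x) = cmod c * norm (x :: 'a::chilbert_space)"
proof -
  have "complex_of_real ((norm (c *\<^sub>C x))\<^sup>2) = c * cnj c * complex_of_real ((norm x)\<^sup>2)"
    by (simp only: cinner_self[symmetric] cinner_scaleC_left cinner_scaleC_right mult.assoc mult.left_commute)
  also have "\<dots> = complex_of_real ((cmod c * norm x)\<^sup>2)"
    by (simp add: complex_norm_square[symmetric] power_mult_distrib)
  finally have "(norm (c *\<^sub>C x))\<^sup>2 = (cmod c * norm x)\<^sup>2"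
    using of_real_eq_iff by blast
  then show ?thesis
    by (simp add: power2_eq_iff_nonneg)
qed

lemma cinner_Cauchy_Schwarz: "cmod (cinner x y) \<le> norm x * norm (y :: 'a::chilbert_space)"
proof (cases "cinner x y = 0")
  case False
  define c where "c = cnj (cinner x y) / cmod (cinner x y)"
  have c: "cmod c = 1"
    using False by (simp add: c_def norm_divide)
  have "c * cinner x y = complex_of_real (cmod (cinner x y))"
    using False
    by (simp add: c_def mult.commute complex_norm_square[symmetric] power2_eq_square)
  then have "cmod (cinner x y) = inner (c *\<^sub>C x) y"
    by (simp add: inner_eq_Re_cinner cinner_scaleC_left)
  also have "\<dots> \<le> norm (c *\<^sub>C x) * norm y"
    by (rule norm_cauchy_schwarz)
  finally show ?thesis
    by (simp add: norm_scaleC c)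
qed simp

definition clinear :: "('a::chilbert_space \<Rightarrow> 'b::chilbert_space) \<Rightarrow> bool"
  where "clinear A \<longleftrightarrow> (\<forall>x y. A (x + y) = A x + A y) \<and> (\<forall>c x. A (c *\<^sub>C x) = c *\<^sub>C A x)"

definition bounded_clinear :: "('a::chilbert_space \<Rightarrow> 'b::chilbert_space) \<Rightarrow> bool"
  where "bounded_clinear A \<longleftrightarrow> clinear A \<and> (\<exists>K. \<forall>x. norm (A x) \<le> K * norm x)"

definition cisometry :: "('a::chilbert_space \<Rightarrow> 'b::chilbert_space) \<Rightarrow> bool"
  where "cisometry V \<longleftrightarrow> clinear V \<and> (\<forall>x. norm (V x) = norm x)"

definition cadjoint :: "('a::chilbert_space \<Rightarrow> 'b::chilbert_space) \<Rightarrow> 'b \<Rightarrow> 'a"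
  where "cadjoint A = (THE B. \<forall>x y. cinner (A x) y = cinner x (B y))"

definition positive_op :: "('a::chilbert_space \<Rightarrow> 'a) \<Rightarrow> bool"
  where "positive_op A \<longleftrightarrow> (\<forall>x. 0 \<le> cinner (A x) x)"

definition closed_csubspace :: "'a::chilbert_space set \<Rightarrow> bool"
  where "closed_csubspace M \<longleftrightarrow>
    0 \<in> M \<and> (\<forall>x\<in>M. \<forall>y\<in>M. x + y \<in> M) \<and> (\<forall>c. \<forall>x\<in>M. c *\<^sub>C x \<in> M) \<and> closed M"

definition orth_proj :: "'a::chilbert_space set \<Rightarrow> 'a \<Rightarrow> 'a"
  where "orth_proj M x = (THE y. y \<in> M \<and> (\<forall>z\<in>M. cinner (x - y) z = 0))"


section \<open>The spaces of square summable families\<close>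

text \<open>
  \<open>('i, 'a) ell2\<close> is the Hilbert space of square summable families in \<open>'a\<close> indexed by the
  whole type \<open>'i\<close>.  It serves as the Hilbert tensor product of \<open>('i, complex) ell2\<close> with \<open>'a\<close>;
  the elementary tensors are given by \<open>tensor_vec\<close> below.
\<close>

typedef (overloaded) ('i, 'a) ell2 =
    "{f :: 'i \<Rightarrow> 'a::chilbert_space. (\<lambda>i. (norm (f i))\<^sup>2) summable_on UNIV}"
  morphisms ell2_nth Abs_ell2
  by (rule exI[of _ "\<lambda>_. 0"]) simp

setup_lifting type_definition_ell2

lemma ell2_summable: "(\<lambda>i. (norm (ell2_nth f i))\<^sup>2) summable_on UNIV"
  using ell2_nth by blast

lemma ell2_eqI: "(\<And>i. ell2_nth f i = ell2_nth g i) \<Longrightarrow> f = g"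
  by (metis ext ell2_nth_inject)

lemma real_summable_comparison:
  fixes f g :: "'i \<Rightarrow> real"
  assumes "g summable_on A" and "\<And>x. \<bar>f x\<bar> \<le> g x"
  shows "f summable_on A"
  using abs_summable_summable[OF Infinite_Sum.abs_summable_on_comparison_test'[OF assms(1), of f]] assms(2)
  by simp

lemma sq_summable_add:
  fixes f g :: "'i \<Rightarrow> 'a::real_normed_vector"
  assumes "(\<lambda>i. (norm (f i))\<^sup>2) summable_on A" "(\<lambda>i. (norm (g i))\<^sup>2) summable_on A"
  shows "(\<lambda>i. (norm (f i + g i))\<^sup>2) summable_on A"
proof (rule real_summable_comparison)
  show "(\<lambda>i. ((norm (f i))\<^sup>2 + (norm (g i))\<^sup>2) * 2) summable_on A"
    by (intro summable_on_cmult_left summable_on_add assms)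
  fix i
  have "(norm (f i + g i))\<^sup>2 \<le> (norm (f i) + norm (g i))\<^sup>2"
    by (intro power_mono norm_triangle_ineq) simp
  also have "\<dots> \<le> ((norm (f i))\<^sup>2 + (norm (g i))\<^sup>2) * 2"
    using sum_squares_bound[of "norm (f i)" "norm (g i)"] by (simp add: power2_sum)
  finally show "\<bar>(norm (f i + g i))\<^sup>2\<bar> \<le> ((norm (f i))\<^sup>2 + (norm (g i))\<^sup>2) * 2"
    by simp
qed

lemma sq_summable_scaleC:
  fixes f :: "'i \<Rightarrow> 'a::chilbert_space"
  assumes "(\<lambda>i. (norm (f i))\<^sup>2) summable_on A"
  shows "(\<lambda>i. (norm (c *\<^sub>C f i))\<^sup>2) summable_on A"
  using summable_on_cmult_right[OF assms, of "(cmod c)\<^sup>2"]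
  by (simp add: norm_scaleC power_mult_distrib)

lemma cinner_summable:
  fixes f g :: "'i \<Rightarrow> 'a::chilbert_space"
  assumes "(\<lambda>i. (norm (f i))\<^sup>2) summable_on A" "(\<lambda>i. (norm (g i))\<^sup>2) summable_on A"
  shows "(\<lambda>i. cinner (f i) (g i)) summable_on A"
proof (rule abs_summable_summable, rule Infinite_Sum.abs_summable_on_comparison_test')
  show "(\<lambda>i. (norm (f i))\<^sup>2 + (norm (g i))\<^sup>2) summable_on A"
    by (intro summable_on_add assms)
  fix i
  have "cmod (cinner (f i) (g i)) \<le> norm (f i) * norm (g i)"
    by (rule cinner_Cauchy_Schwarz)
  also have "\<dots> \<le> 2 * (norm (f i) * norm (g i))"
    by simp
  also have "\<dots> \<le> (norm (f i))\<^sup>2 + (norm (g i))\<^sup>2"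
    using sum_squares_bound[of "norm (f i)" "norm (g i)"] by simp
  finally show "cmod (cinner (f i) (g i)) \<le> (norm (f i))\<^sup>2 + (norm (g i))\<^sup>2" .
qed

instantiation ell2 :: (type, chilbert_space) real_inner
begin

lift_definition zero_ell2 :: "('a, 'b) ell2" is "\<lambda>_. 0"
  by simp

lift_definition plus_ell2 :: "('a, 'b) ell2 \<Rightarrow> ('a, 'b) ell2 \<Rightarrow> ('a, 'b) ell2"
  is "\<lambda>f g i. f i + g i"
  by (rule sq_summable_add)

lift_definition scaleR_ell2 :: "real \<Rightarrow> ('a, 'b) ell2 \<Rightarrow> ('a, 'b) ell2"
  is "\<lambda>r f i. r *\<^sub>R f i"
  by (subst (1) scaleR_scaleC) (rule sq_summable_scaleC)

lift_definition uminus_ell2 :: "('a, 'b) ell2 \<Rightarrow> ('a, 'b) ell2" is "\<lambda>f i. - f i"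
  by simp

definition minus_ell2 :: "('a, 'b) ell2 \<Rightarrow> ('a, 'b) ell2 \<Rightarrow> ('a, 'b) ell2"
  where "minus_ell2 f g = f + - g"

definition inner_ell2 :: "('a, 'b) ell2 \<Rightarrow> ('a, 'b) ell2 \<Rightarrow> real"
  where "inner_ell2 f g = Re (\<Sum>\<^sub>\<infinity>i. cinner (ell2_nth f i) (ell2_nth g i))"

definition norm_ell2 :: "('a, 'b) ell2 \<Rightarrow> real"
  where "norm_ell2 f = sqrt (inner f f)"

definition dist_ell2 :: "('a, 'b) ell2 \<Rightarrow> ('a, 'b) ell2 \<Rightarrow> real"
  where "dist_ell2 f g = norm (f - g)"

definition sgn_ell2 :: "('a, 'b) ell2 \<Rightarrow> ('a, 'b) ell2"
  where "sgn_ell2 f = inverse (norm f) *\<^sub>R f"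

definition uniformity_ell2 :: "(('a, 'b) ell2 \<times> ('a, 'b) ell2) filter"
  where "uniformity_ell2 = (INF e\<in>{0 <..}. principal {(x, y). dist x y < e})"

definition open_ell2 :: "('a, 'b) ell2 set \<Rightarrow> bool"
  where "open_ell2 U \<longleftrightarrow> (\<forall>x\<in>U. eventually (\<lambda>(x', y). x' = x \<longrightarrow> y \<in> U) uniformity)"

lemma ell2_nth_simps [simp]:
  "ell2_nth (0 :: ('a, 'b) ell2) i = 0"
  "ell2_nth (f + g :: ('a, 'b) ell2) i = ell2_nth f i + ell2_nth g i"
  "ell2_nth (r *\<^sub>R f :: ('a, 'b) ell2) i = r *\<^sub>R ell2_nth f i"
  "ell2_nth (- f :: ('a, 'b) ell2) i = - ell2_nth f i"
  "ell2_nth (f - g :: ('a, 'b) ell2) i = ell2_nth f i - ell2_nth g i"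
  by (simp_all add: zero_ell2.rep_eq plus_ell2.rep_eq scaleR_ell2.rep_eq
      uminus_ell2.rep_eq minus_ell2_def)

lemma ell2_cinner_summable: "(\<lambda>i. cinner (ell2_nth f i) (ell2_nth g i :: 'b)) summable_on A"
  by (rule summable_on_subset_banach[OF cinner_summable[OF ell2_summable ell2_summable] subset_UNIV])

lemma ell2_norm_sq: "(norm (f :: ('a, 'b) ell2))\<^sup>2 = (\<Sum>\<^sub>\<infinity>i. (norm (ell2_nth f i))\<^sup>2)"
  and ell2_inner_self: "inner f f = (\<Sum>\<^sub>\<infinity>i. (norm (ell2_nth f i))\<^sup>2)"
proof -
  show *: "inner f f = (\<Sum>\<^sub>\<infinity>i. (norm (ell2_nth f i))\<^sup>2)" for f :: "('a, 'b) ell2"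
    unfolding inner_ell2_def
    by (subst infsum_Re[OF ell2_cinner_summable, symmetric])
       (simp add: cinner_self)
  show "(norm (f :: ('a, 'b) ell2))\<^sup>2 = (\<Sum>\<^sub>\<infinity>i. (norm (ell2_nth f i))\<^sup>2)"
    unfolding norm_ell2_def * by (simp add: infsum_nonneg)
qed

lemma ell2_norm_le:
  fixes f :: "'a \<Rightarrow> 'b"
  assumes "\<And>F. finite F \<Longrightarrow> (\<Sum>i\<in>F. (norm (f i))\<^sup>2) \<le> e"
  shows "(\<lambda>i. (norm (f i))\<^sup>2) summable_on UNIV" "(\<Sum>\<^sub>\<infinity>i. (norm (f i))\<^sup>2) \<le> e"
proof -
  show *: "(\<lambda>i. (norm (f i))\<^sup>2) summable_on UNIV"
    by (rule nonneg_bdd_above_summable_on) (auto intro!: bdd_aboveI2[where M = e] assms)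
  show "(\<Sum>\<^sub>\<infinity>i. (norm (f i))\<^sup>2) \<le> e"
    by (rule infsum_le_finite_sums[OF *]) (use assms in auto)
qed

lemma ell2_sum_le_norm:
  assumes "finite F"
  shows "(\<Sum>i\<in>F. (norm (ell2_nth (f :: ('a, 'b) ell2) i))\<^sup>2) \<le> (norm f)\<^sup>2"
  unfolding ell2_norm_sq by (rule finite_sum_le_infsum) (use assms ell2_summable in auto)

lemma ell2_nth_le_norm: "norm (ell2_nth (f :: ('a, 'b) ell2) i) \<le> norm f"
proof -
  have "0 \<le> norm f"
    by (simp add: norm_ell2_def ell2_inner_self infsum_nonneg)
  then show ?thesis
    using ell2_sum_le_norm[of "{i}" f] by (simp add: power2_le_iff_abs_le)
qed

instance
proof
  fix x y z :: "('a, 'b) ell2" and a b r :: real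
  show "x + y + z = x + (y + z)" "x + y = y + x" "0 + x = x" "- x + x = 0"
    by (auto intro!: ell2_eqI simp: add_ac)
  show "x - y = x + - y"
    by (rule minus_ell2_def)
  show "a *\<^sub>R (x + y) = a *\<^sub>R x + a *\<^sub>R y" "(a + b) *\<^sub>R x = a *\<^sub>R x + b *\<^sub>R x"
    "a *\<^sub>R b *\<^sub>R x = (a * b) *\<^sub>R x" "1 *\<^sub>R x = x"
    by (auto intro!: ell2_eqI simp: scaleR_add_right scaleR_add_left)
  show "sgn x = inverse (norm x) *\<^sub>R x" "dist x y = norm (x - y)" "norm x = sqrt (inner x x)"
    "uniformity = (INF e\<in>{0 <..}. principal {(x, y :: ('a, 'b) ell2). dist x y < e})"
    by (rule sgn_ell2_def dist_ell2_def norm_ell2_def uniformity_ell2_def)+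
  show "open U \<longleftrightarrow> (\<forall>x\<in>U. eventually (\<lambda>(x', y). x' = x \<longrightarrow> y \<in> U) uniformity)"
    for U :: "('a, 'b) ell2 set"
    by (rule open_ell2_def)
  show "inner x y = inner y x"
  proof -
    have "(\<Sum>\<^sub>\<infinity>i. cinner (ell2_nth x i) (ell2_nth y i))
        = cnj (\<Sum>\<^sub>\<infinity>i. cinner (ell2_nth y i) (ell2_nth x i))"
      by (subst infsum_cnj[symmetric]) (metis cinner_commute)
    then show ?thesis
      by (simp add: inner_ell2_def)
  qed
  show "inner (x + y) z = inner x z + inner y z"
    by (simp add: inner_ell2_def cinner_add_left infsum_add ell2_cinner_summable)
  show "inner (a *\<^sub>R x) y = a * inner x y"
    by (simp add: inner_ell2_def scaleR_scaleC cinner_scaleC_left infsum_cmult_right')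
  show "0 \<le> inner x x"
    unfolding ell2_inner_self by (simp add: infsum_nonneg)
  show "inner x x = 0 \<longleftrightarrow> x = 0"
  proof
    assume "inner x x = 0"
    then have "norm x = 0"
      by (simp add: norm_ell2_def)
    then show "x = 0"
      using ell2_nth_le_norm[of x] by (auto intro!: ell2_eqI)
  next
    assume "x = 0"
    then show "inner x x = 0"
      by (simp add: ell2_inner_self)
  qed
qed

end

instance ell2 :: (type, chilbert_space) complete_space
proof
  fix X :: "nat \<Rightarrow> ('a, 'b) ell2"
  assume "Cauchy X"
  then have C: "\<exists>M. \<forall>m\<ge>M. \<forall>n\<ge>M. norm (X m - X n) < e" if "e > 0" for e
    using that CauchyD by blast
  have "\<exists>L. (\<lambda>m. ell2_nth (X m) i) \<longlonglongrightarrow> L" for i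
  proof -
    have "Cauchy (\<lambda>m. ell2_nth (X m) i)"
    proof (rule CauchyI)
      fix e :: real assume "0 < e"
      then obtain M where "\<forall>m\<ge>M. \<forall>n\<ge>M. norm (X m - X n) < e"
        using C by blast
      moreover have "norm (ell2_nth (X m) i - ell2_nth (X n) i) \<le> norm (X m - X n)" for m n
        using ell2_nth_le_norm[of "X m - X n" i] by simp
      ultimately show "\<exists>M. \<forall>m\<ge>M. \<forall>n\<ge>M. norm (ell2_nth (X m) i - ell2_nth (X n) i) < e"
        by (meson le_less_trans)
    qed
    then show ?thesis
      using Cauchy_convergent convergent_def by blast
  qed
  then obtain L where L: "\<And>i. (\<lambda>m. ell2_nth (X m) i) \<longlonglongrightarrow> L i"
    by metis
  have close: "\<exists>M. \<forall>m\<ge>M. \<forall>F. finite F \<longrightarrow> (\<Sum>i\<in>F. (norm (ell2_nth (X m) i - L i))\<^sup>2) \<le> e\<^sup>2"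
    if e: "e > 0" for e
  proof -
    from C[OF e] obtain M where M: "\<And>m p. m \<ge> M \<Longrightarrow> p \<ge> M \<Longrightarrow> norm (X m - X p) < e"
      by blast
    have "(\<Sum>i\<in>F. (norm (ell2_nth (X m) i - L i))\<^sup>2) \<le> e\<^sup>2" if m: "m \<ge> M" and F: "finite F" for m F
    proof (rule tendsto_upperbound)
      show "(\<lambda>p. \<Sum>i\<in>F. (norm (ell2_nth (X m) i - ell2_nth (X p) i))\<^sup>2)
          \<longlonglongrightarrow> (\<Sum>i\<in>F. (norm (ell2_nth (X m) i - L i))\<^sup>2)"
        by (intro tendsto_intros L)
      have "(\<Sum>i\<in>F. (norm (ell2_nth (X m) i - ell2_nth (X p) i))\<^sup>2) \<le> e\<^sup>2" if "p \<ge> M" for p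
      proof -
        have "(\<Sum>i\<in>F. (norm (ell2_nth (X m - X p) i))\<^sup>2) \<le> (norm (X m - X p))\<^sup>2"
          by (rule ell2_sum_le_norm[OF F])
        also have "\<dots> \<le> e\<^sup>2"
          using M[OF m that] by (intro power_mono) simp_all
        finally show ?thesis
          by simp
      qed
      then show "\<forall>\<^sub>F p in sequentially. (\<Sum>i\<in>F. (norm (ell2_nth (X m) i - ell2_nth (X p) i))\<^sup>2) \<le> e\<^sup>2"
        by (auto simp: eventually_sequentially)
    qed simp
    then show ?thesis
      by blast
  qed
  obtain M where M: "\<And>F. finite F \<Longrightarrow> (\<Sum>i\<in>F. (norm (ell2_nth (X M) i - L i))\<^sup>2) \<le> 1"
    using close[OF zero_less_one] unfolding power_one by blast
  have "(\<lambda>i. (norm (L i - ell2_nth (X M) i))\<^sup>2) summable_on UNIV"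
    using ell2_norm_le(1)[OF M] by (simp add: norm_minus_commute)
  from sq_summable_add[OF this ell2_summable[of "X M"]]
  have Ls: "(\<lambda>i. (norm (L i))\<^sup>2) summable_on UNIV"
    by simp
  define Y :: "('a, 'b) ell2" where "Y = Abs_ell2 L"
  have Y: "ell2_nth Y = L"
    unfolding Y_def by (rule Abs_ell2_inverse) (use Ls in simp)
  have "\<exists>M. \<forall>m\<ge>M. dist (X m) Y < e" if e: "e > 0" for e
  proof -
    obtain M where M: "\<And>m F. m \<ge> M \<Longrightarrow> finite F \<Longrightarrow>
        (\<Sum>i\<in>F. (norm (ell2_nth (X m) i - L i))\<^sup>2) \<le> (e / 2)\<^sup>2"
      using close[OF half_gt_zero[OF e]] by blast
    have "dist (X m) Y < e" if "m \<ge> M" for m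
    proof -
      have "(norm (X m - Y))\<^sup>2 \<le> (e / 2)\<^sup>2"
        unfolding ell2_norm_sq using ell2_norm_le(2)[OF M[OF that]] by (simp add: Y)
      then have "norm (X m - Y) \<le> e / 2"
        by (rule power2_le_imp_le) (use e in simp)
      then show ?thesis
        using e by (simp add: dist_norm)
    qed
    then show ?thesis
      by blast
  qed
  then have "X \<longlonglongrightarrow> Y"
    by (simp add: lim_sequentially)
  then show "convergent X"
    by (rule convergentI)
qed

instantiation ell2 :: (type, chilbert_space) chilbert_space
begin

lift_definition scaleC_ell2 :: "complex \<Rightarrow> ('a, 'b) ell2 \<Rightarrow> ('a, 'b) ell2"
  is "\<lambda>c f i. c *\<^sub>C f i"
  by (rule sq_summable_scaleC)

definition cinner_ell2 :: "('a, 'b) ell2 \<Rightarrow> ('a, 'b) ell2 \<Rightarrow> complex"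
  where "cinner_ell2 f g = (\<Sum>\<^sub>\<infinity>i. cinner (ell2_nth f i) (ell2_nth g i))"

lemma ell2_nth_scaleC [simp]:
  "ell2_nth (c *\<^sub>C f :: ('a, 'b) ell2) i = c *\<^sub>C ell2_nth f i"
  by (simp add: scaleC_ell2.rep_eq)

instance
proof
  fix x y z :: "('a, 'b) ell2" and r :: real and c d :: complex
  show "c *\<^sub>C (x + y) = c *\<^sub>C x + c *\<^sub>C y"
    by (rule ell2_eqI) (simp add: scaleC_add_right)
  show "(c + d) *\<^sub>C x = c *\<^sub>C x + d *\<^sub>C x"
    by (rule ell2_eqI) (simp add: scaleC_add_left)
  show "c *\<^sub>C d *\<^sub>C x = (c * d) *\<^sub>C x"
    by (rule ell2_eqI) (simp add: scaleC_scaleC)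
  show "r *\<^sub>R x = complex_of_real r *\<^sub>C x"
    by (rule ell2_eqI) (simp add: scaleR_scaleC)
  show "cinner x y = cnj (cinner y x)"
    unfolding cinner_ell2_def infsum_cnj[symmetric] by (intro infsum_cong cinner_commute)
  show "cinner (x + y) z = cinner x z + cinner y z"
    by (simp add: cinner_ell2_def cinner_add_left infsum_add ell2_cinner_summable)
  show "cinner (c *\<^sub>C x) y = c * cinner x y"
    by (simp add: cinner_ell2_def cinner_scaleC_left infsum_cmult_right')
  show "inner x y = Re (cinner x y)"
    by (simp add: cinner_ell2_def inner_ell2_def)
qed

end

lift_definition ell2_single :: "'i \<Rightarrow> 'a::chilbert_space \<Rightarrow> ('i, 'a) ell2"
  is "\<lambda>i x j. if j = i then x else 0"
proof -
  fix i :: 'i and x :: 'a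
  have "{j. (norm (if j = i then x else 0))\<^sup>2 \<noteq> 0} \<subseteq> {i}"
    by auto
  then show "(\<lambda>j. (norm (if j = i then x else 0))\<^sup>2) summable_on UNIV"
    by (intro finite_nonzero_values_imp_summable_on) (auto intro: finite_subset)
qed

abbreviation chi :: "'i \<Rightarrow> ('i, complex) ell2"
  where "chi i \<equiv> ell2_single i 1"

lift_definition tensor_vec :: "('i, complex) ell2 \<Rightarrow> 'a::chilbert_space \<Rightarrow> ('i, 'a) ell2"
  is "\<lambda>f x i. f i *\<^sub>C x"
  by (simp add: norm_scaleC power_mult_distrib summable_on_cmult_left)

lemma cinner_tensor_vec:
  "cinner (tensor_vec f x) (tensor_vec g y) = cinner f g * cinner x (y :: 'a::chilbert_space)"
proof -
  have "cinner (a *\<^sub>C x) (b *\<^sub>C y) = cinner a b * cinner x y" for a b :: complex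
    by (simp only: cinner_scaleC_left cinner_scaleC_right cinner_complex_def mult_ac)
  then show ?thesis
    by (simp add: cinner_ell2_def tensor_vec.rep_eq infsum_cmult_left')
qed

lemma tensor_vec_chi: "tensor_vec (chi i) x = ell2_single i x"
  by (rule ell2_eqI) (simp add: tensor_vec.rep_eq ell2_single.rep_eq)

text \<open>\<open>tensor_id A\<close> is the operator \<open>A \<otimes> I\<close>.\<close>

definition tensor_id ::
    "(('i, complex) ell2 \<Rightarrow> ('i, complex) ell2) \<Rightarrow> ('i, 'a::chilbert_space) ell2 \<Rightarrow> ('i, 'a) ell2"
  where "tensor_id A = (THE B. bounded_clinear B \<and> (\<forall>f x. B (tensor_vec f x) = tensor_vec (A f) x))"

text \<open>
  For a closed subspace \<open>D\<close> of \<open>'a\<close>, \<open>ell2_on X D\<close> is the copy of \<open>\<ell>\<^sup>2(X) \<otimes> D\<close> inside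
  \<open>('i, 'a) ell2\<close>.
\<close>

definition ell2_on :: "'i set \<Rightarrow> 'a::chilbert_space set \<Rightarrow> ('i, 'a) ell2 set"
  where "ell2_on X D = {f. (\<forall>i\<in>X. ell2_nth f i \<in> D) \<and> (\<forall>i. i \<notin> X \<longrightarrow> ell2_nth f i = 0)}"

lemma ell2_nth_sum_single:
  assumes "finite F"
  shows "ell2_nth (\<Sum>i\<in>F. ell2_single i (g i)) j = (if j \<in> F then g j else 0)"
  using assms by (induction F rule: finite_induct) (auto simp: ell2_single.rep_eq)

lemma ell2_approx:
  fixes f :: "('i, 'a::chilbert_space) ell2"
  assumes "e > 0"
  shows "\<exists>F. finite F \<and> norm (f - (\<Sum>i\<in>F. ell2_single i (ell2_nth f i))) < e"
proof -
  let ?g = "\<lambda>i. (norm (ell2_nth f i))\<^sup>2"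
  have "(?g has_sum (norm f)\<^sup>2) UNIV"
    unfolding ell2_norm_sq using ell2_summable by (rule has_sum_infsum)
  then have "(sum ?g \<longlongrightarrow> (norm f)\<^sup>2) (finite_subsets_at_top UNIV)"
    by (simp add: has_sum_def)
  from tendstoD[OF this, of "e\<^sup>2"] assms obtain F
    where F: "finite F" "\<bar>sum ?g F - (norm f)\<^sup>2\<bar> < e\<^sup>2"
    by (auto simp: eventually_finite_subsets_at_top dist_real_def)
  let ?h = "f - (\<Sum>i\<in>F. ell2_single i (ell2_nth f i))"
  have "(norm ?h)\<^sup>2 = (\<Sum>\<^sub>\<infinity>i. if i \<in> F then 0 else ?g i)"
    unfolding ell2_norm_sq by (intro infsum_cong) (simp add: ell2_nth_sum_single F)
  also have "\<dots> = infsum ?g (UNIV - F)"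
    by (rule infsum_cong_neutral) auto
  also have "\<dots> = (norm f)\<^sup>2 - sum ?g F"
    unfolding ell2_norm_sq using F by (subst infsum_Diff) (auto simp: ell2_summable)
  also have "\<dots> < e\<^sup>2"
    using F by simp
  finally show ?thesis
    using F assms by (meson less_imp_le power2_less_imp_less)
qed

lemma clinear_simps:
  assumes "clinear A"
  shows "A 0 = 0" "A (x + y) = A x + A y" "A (c *\<^sub>C x) = c *\<^sub>C A x" "A (- x) = - A x"
    "A (x - y) = A x - A y" "A (sum h F) = (\<Sum>i\<in>F. A (h i))"
proof -
  have A: "A (x + y) = A x + A y" "A (c *\<^sub>C x) = c *\<^sub>C A x" for x y c
    using assms by (auto simp: clinear_def)
  show zero: "A 0 = 0"
    using A(2)[of 0 0] by simp
  have minus: "A (- x) = - A x" for x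
    using A(1)[of x "- x"] zero by (simp add: eq_neg_iff_add_eq_0 add.commute)
  show "A (- x) = - A x"
    by (rule minus)
  show "A (x - y) = A x - A y"
    using A(1)[of x "- y"] minus by simp
  show "A (sum h F) = (\<Sum>i\<in>F. A (h i))"
    by (induction F rule: infinite_finite_induct) (auto simp: zero A)
qed (use assms in \<open>auto simp: clinear_def\<close>)

lemma bounded_clinear_ell2_eqI:
  fixes A B :: "('i, 'a::chilbert_space) ell2 \<Rightarrow> 'b::chilbert_space"
  assumes A: "bounded_clinear A" and B: "bounded_clinear B"
    and eq: "\<And>i x. A (ell2_single i x) = B (ell2_single i x)"
  shows "A = B"
proof
  fix f
  obtain K where K: "\<And>x. norm (A x) \<le> K * norm x"
    using A by (auto simp: bounded_clinear_def)
  obtain L where L: "\<And>x. norm (B x) \<le> L * norm x"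
    using B by (auto simp: bounded_clinear_def)
  have lin: "clinear A" "clinear B"
    using A B by (auto simp: bounded_clinear_def)
  show "A f = B f"
  proof (rule ccontr)
    assume "A f \<noteq> B f"
    then have pos: "norm (A f - B f) > 0"
      by simp
    define c where "c = \<bar>K\<bar> + \<bar>L\<bar> + 1"
    have c: "c > 0"
      by (simp add: c_def)
    obtain F where F: "finite F"
      "norm (f - (\<Sum>i\<in>F. ell2_single i (ell2_nth f i))) < norm (A f - B f) / c"
      using ell2_approx[of "norm (A f - B f) / c" f] pos c by auto
    let ?h = "f - (\<Sum>i\<in>F. ell2_single i (ell2_nth f i))"
    have "A f - B f = A ?h - B ?h"
      by (simp add: clinear_simps[OF lin(1)] clinear_simps[OF lin(2)] eq)
    also have "norm \<dots> \<le> norm (A ?h) + norm (B ?h)"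
      by (rule norm_triangle_ineq4)
    also have "\<dots> \<le> K * norm ?h + L * norm ?h"
      by (intro add_mono K L)
    also have "\<dots> \<le> c * norm ?h"
      unfolding distrib_right[symmetric] c_def by (intro mult_right_mono) auto
    also have "\<dots> < norm (A f - B f)"
      using F(2) c by (simp add: field_simps)
    finally show False
      by simp
  qed
qed


section \<open>The standard tuple\<close>

text \<open>
  Words over the generators \<open>1, \<dots>, n i\<close> are lists.
\<close>

definition tuples :: "nat \<Rightarrow> (nat \<Rightarrow> nat) \<Rightarrow> (nat \<Rightarrow> nat list) set"
  where "tuples k n = (\<Pi>\<^sub>E i\<in>{1..k}. lists {1..n i})"

definition lam_word :: "(nat \<Rightarrow> nat \<Rightarrow> nat \<Rightarrow> nat \<Rightarrow> complex) \<Rightarrow> nat \<Rightarrow> nat \<Rightarrow> nat \<Rightarrow> nat list \<Rightarrow> complex"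
  where "lam_word lam i j s w = prod_list (map (lam i j s) w)"

definition lam_coeff ::
    "(nat \<Rightarrow> nat \<Rightarrow> nat \<Rightarrow> nat \<Rightarrow> complex) \<Rightarrow> nat \<Rightarrow> nat \<Rightarrow> (nat \<Rightarrow> nat list) \<Rightarrow> complex"
  where "lam_coeff lam i s \<alpha> = (\<Prod>j\<in>{1..<i}. lam_word lam i j s (\<alpha> j))"

text \<open>
  The space \<open>\<ell>\<^sup>2(tuples k n)\<close> is a subspace of the family space over the whole type
  \<open>nat \<Rightarrow> nat list\<close>; the shift is extended by zero on its orthogonal complement.  The subspaces
  \<open>ell2_on (tuples k n) D\<close> are then reducing for \<open>tensor_id (shift k n lam i s)\<close>, so that taking
  adjoints commutes with the restriction to them.
\<close>

definition shift ::
    "nat \<Rightarrow> (nat \<Rightarrow> nat) \<Rightarrow> (nat \<Rightarrow> nat \<Rightarrow> nat \<Rightarrow> nat \<Rightarrow> complex) \<Rightarrow> nat \<Rightarrow> nat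
      \<Rightarrow> (nat \<Rightarrow> nat list, complex) ell2 \<Rightarrow> (nat \<Rightarrow> nat list, complex) ell2"
  where "shift k n lam i s = (THE A. bounded_clinear A
    \<and> (\<forall>\<alpha>\<in>tuples k n. A (chi \<alpha>) = lam_coeff lam i s \<alpha> *\<^sub>C chi (\<alpha>(i := s # \<alpha> i)))
    \<and> (\<forall>\<alpha>. \<alpha> \<notin> tuples k n \<longrightarrow> A (chi \<alpha>) = 0))"

definition phase_matrices ::
    "nat \<Rightarrow> (nat \<Rightarrow> nat) \<Rightarrow> (nat \<Rightarrow> nat \<Rightarrow> nat \<Rightarrow> nat \<Rightarrow> complex) \<Rightarrow> bool"
  where "phase_matrices k n lam \<longleftrightarrow>
    (\<forall>i\<in>{1..k}. \<forall>j\<in>{1..k}. i \<noteq> j \<longrightarrow> (\<forall>s\<in>{1..n i}. \<forall>t\<in>{1..n j}.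
      cmod (lam i j s t) = 1 \<and> lam j i t s = cnj (lam i j s t)))"

text \<open>
  The next lemmas show that the operators described by \<open>shift\<close> and \<open>tensor_id\<close> exist: both are
  the following weighted composition operator, scalar and vector valued.
\<close>

definition wcomp :: "'i set \<Rightarrow> ('i \<Rightarrow> 'j) \<Rightarrow> ('i \<Rightarrow> complex) \<Rightarrow> ('i, 'a::chilbert_space) ell2 \<Rightarrow> ('j, 'a) ell2"
  where "wcomp X \<sigma> c f = Abs_ell2 (\<lambda>j. if j \<in> \<sigma> ` X
    then c (inv_into X \<sigma> j) *\<^sub>C ell2_nth f (inv_into X \<sigma> j) else 0)"

lemma wcomp:
  fixes f :: "('i, 'a::chilbert_space) ell2"
  assumes inj: "inj_on \<sigma> X" and c: "\<forall>i\<in>X. cmod (c i) = 1"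
  shows ell2_nth_wcomp: "ell2_nth (wcomp X \<sigma> c f) j = (if j \<in> \<sigma> ` X
      then c (inv_into X \<sigma> j) *\<^sub>C ell2_nth f (inv_into X \<sigma> j) else 0)"
    and norm_wcomp: "norm (wcomp X \<sigma> c f) \<le> norm f"
proof -
  let ?g = "\<lambda>j. if j \<in> \<sigma> ` X then c (inv_into X \<sigma> j) *\<^sub>C ell2_nth f (inv_into X \<sigma> j) else 0"
  have le: "(\<Sum>j\<in>F. (norm (?g j))\<^sup>2) \<le> (norm f)\<^sup>2" if "finite F" for F
  proof -
    have "(\<Sum>j\<in>F. (norm (?g j))\<^sup>2) = (\<Sum>j\<in>F \<inter> \<sigma> ` X. (norm (?g j))\<^sup>2)"
      by (rule sum.mono_neutral_right) (use that in auto)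
    also have "\<dots> = (\<Sum>j\<in>F \<inter> \<sigma> ` X. (norm (ell2_nth f (inv_into X \<sigma> j)))\<^sup>2)"
      by (rule sum.cong) (auto simp: norm_scaleC c inv_into_into)
    also have "\<dots> = (\<Sum>i\<in>inv_into X \<sigma> ` (F \<inter> \<sigma> ` X). (norm (ell2_nth f i))\<^sup>2)"
      by (subst sum.reindex) (auto intro: inj_on_subset[OF inj_on_inv_into])
    also have "\<dots> \<le> (norm f)\<^sup>2"
      by (rule ell2_sum_le_norm) (use that in simp)
    finally show ?thesis .
  qed
  have "ell2_nth (wcomp X \<sigma> c f) = ?g"
    unfolding wcomp_def by (rule Abs_ell2_inverse) (use ell2_norm_le(1)[OF le] in simp)
  then show *: "ell2_nth (wcomp X \<sigma> c f) j = ?g j" for j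
    by simp
  have "(norm (wcomp X \<sigma> c f))\<^sup>2 \<le> (norm f)\<^sup>2"
    unfolding ell2_norm_sq[of "wcomp X \<sigma> c f"] * using ell2_norm_le(2)[OF le] .
  then show "norm (wcomp X \<sigma> c f) \<le> norm f"
    by (rule power2_le_imp_le) simp
qed

context
  fixes X :: "'i set" and \<sigma> :: "'i \<Rightarrow> 'j" and c :: "'i \<Rightarrow> complex"
  assumes inj: "inj_on \<sigma> X" and c: "\<forall>i\<in>X. cmod (c i) = 1"
begin

lemma bounded_clinear_wcomp:
  "bounded_clinear (wcomp X \<sigma> c :: ('i, 'a::chilbert_space) ell2 \<Rightarrow> _)"
  unfolding bounded_clinear_def clinear_def
  by (auto intro!: ell2_eqI exI[of _ 1]
      simp: ell2_nth_wcomp[OF inj c] norm_wcomp[OF inj c] scaleC_add_right scaleC_scaleC mult.commute)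

lemma wcomp_single:
  "wcomp X \<sigma> c (ell2_single i x) =
    (if i \<in> X then c i *\<^sub>C ell2_single (\<sigma> i) x else (0 :: ('j, 'a::chilbert_space) ell2))"
proof (rule ell2_eqI)
  fix j
  show "ell2_nth (wcomp X \<sigma> c (ell2_single i x)) j =
      ell2_nth (if i \<in> X then c i *\<^sub>C ell2_single (\<sigma> i) x else (0 :: ('j, 'a) ell2)) j"
  proof (cases "j \<in> \<sigma> ` X")
    case True
    then obtain l where "l \<in> X" "j = \<sigma> l"
      by blast
    then show ?thesis
      using inj by (auto simp: ell2_nth_wcomp[OF inj c] ell2_single.rep_eq dest: inj_onD)
  next
    case False
    then show ?thesis
      by (auto simp: ell2_nth_wcomp[OF inj c] ell2_single.rep_eq)
  qed
qed

lemma wcomp_tensor_vec: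
  "wcomp X \<sigma> c (tensor_vec f x) = tensor_vec (wcomp X \<sigma> c f) (x :: 'a::chilbert_space)"
  by (rule ell2_eqI) (simp add: ell2_nth_wcomp[OF inj c] tensor_vec.rep_eq scaleC_scaleC
      scaleC_complex_def)

end

lemma tensor_id_wcomp:
  fixes \<sigma> :: "'i \<Rightarrow> 'i"
  assumes "inj_on \<sigma> X" "\<forall>i\<in>X. cmod (c i) = 1"
  shows "tensor_id (wcomp X \<sigma> c) = (wcomp X \<sigma> c :: ('i, 'a::chilbert_space) ell2 \<Rightarrow> _)"
  unfolding tensor_id_def
proof (rule the_equality)
  show "bounded_clinear (wcomp X \<sigma> c :: ('i, 'a) ell2 \<Rightarrow> _) \<and>
      (\<forall>f (x :: 'a). wcomp X \<sigma> c (tensor_vec f x) = tensor_vec (wcomp X \<sigma> c f) x)"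
    using bounded_clinear_wcomp[OF assms] wcomp_tensor_vec[OF assms] by blast
  fix B :: "('i, 'a) ell2 \<Rightarrow> ('i, 'a) ell2"
  assume B: "bounded_clinear B \<and> (\<forall>f x. B (tensor_vec f x) = tensor_vec (wcomp X \<sigma> c f) x)"
  have "B (ell2_single i x) = wcomp X \<sigma> c (ell2_single i x)" for i x
    using B wcomp_tensor_vec[OF assms] by (metis tensor_vec_chi)
  with B bounded_clinear_wcomp[OF assms] show "B = wcomp X \<sigma> c"
    by (intro bounded_clinear_ell2_eqI) auto
qed

lemma cmod_lam_coeff:
  assumes "phase_matrices k n lam" "i \<in> {1..k}" "s \<in> {1..n i}" "\<alpha> \<in> tuples k n"
  shows "cmod (lam_coeff lam i s \<alpha>) = 1"
proof -
  have word: "cmod (lam_word lam i j s w) = 1"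
    if "j \<in> {1..k}" "j \<noteq> i" "w \<in> lists {1..n j}" for j w
    using that(3)
  proof (induction w)
    case (Cons t w)
    then have "cmod (lam i j s t) = 1"
      using assms(1-3) that(1,2) unfolding phase_matrices_def by metis
    with Cons show ?case
      by (simp add: lam_word_def norm_mult)
  qed (simp add: lam_word_def)
  show ?thesis
    unfolding lam_coeff_def prod_norm[symmetric]
    by (rule prod.neutral) (use assms word in \<open>auto simp: tuples_def PiE_iff\<close>)
qed

lemma inj_on_prepend: "inj_on (\<lambda>\<alpha>. \<alpha>(i := s # \<alpha> i)) (X :: (nat \<Rightarrow> nat list) set)"
proof (rule inj_onI)
  fix \<alpha> \<beta> :: "nat \<Rightarrow> nat list"
  assume eq: "\<alpha>(i := s # \<alpha> i) = \<beta>(i := s # \<beta> i)"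
  show "\<alpha> = \<beta>"
  proof
    fix j
    show "\<alpha> j = \<beta> j"
      using fun_cong[OF eq, of j] by (cases "j = i") auto
  qed
qed

lemma shift_eq_wcomp:
  assumes "phase_matrices k n lam" "i \<in> {1..k}" "s \<in> {1..n i}"
  shows "shift k n lam i s = wcomp (tuples k n) (\<lambda>\<alpha>. \<alpha>(i := s # \<alpha> i)) (lam_coeff lam i s)"
    (is "_ = ?W")
  unfolding shift_def
proof (rule the_equality)
  have "\<forall>\<alpha>\<in>tuples k n. cmod (lam_coeff lam i s \<alpha>) = 1"
    using cmod_lam_coeff[OF assms] by blast
  note W = inj_on_prepend this
  have bounded: "bounded_clinear ?W"
    by (rule bounded_clinear_wcomp[OF W])
  have basis: "?W (chi \<alpha>) = (if \<alpha> \<in> tuples k n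
      then lam_coeff lam i s \<alpha> *\<^sub>C chi (\<alpha>(i := s # \<alpha> i)) else 0)" for \<alpha>
    by (rule wcomp_single[OF W])
  show "bounded_clinear ?W
    \<and> (\<forall>\<alpha>\<in>tuples k n. ?W (chi \<alpha>) = lam_coeff lam i s \<alpha> *\<^sub>C chi (\<alpha>(i := s # \<alpha> i)))
    \<and> (\<forall>\<alpha>. \<alpha> \<notin> tuples k n \<longrightarrow> ?W (chi \<alpha>) = 0)"
    unfolding basis using bounded by simp
  fix A :: "(nat \<Rightarrow> nat list, complex) ell2 \<Rightarrow> (nat \<Rightarrow> nat list, complex) ell2"
  assume A: "bounded_clinear A
    \<and> (\<forall>\<alpha>\<in>tuples k n. A (chi \<alpha>) = lam_coeff lam i s \<alpha> *\<^sub>C chi (\<alpha>(i := s # \<alpha> i)))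
    \<and> (\<forall>\<alpha>. \<alpha> \<notin> tuples k n \<longrightarrow> A (chi \<alpha>) = 0)"
  show "A = ?W"
  proof (rule bounded_clinear_ell2_eqI)
    fix \<alpha> :: "nat \<Rightarrow> nat list" and z :: complex
    have "ell2_single \<alpha> z = z *\<^sub>C chi \<alpha>"
      by (rule ell2_eqI) (simp add: ell2_single.rep_eq scaleC_complex_def)
    moreover have "A (chi \<alpha>) = ?W (chi \<alpha>)"
      unfolding basis using A by simp
    moreover have "clinear A" "clinear ?W"
      using A bounded by (simp_all only: bounded_clinear_def)
    ultimately show "A (ell2_single \<alpha> z) = ?W (ell2_single \<alpha> z)"
      by (simp only: clinear_simps)
  qed (rule A[THEN conjunct1], rule bounded)
qed

lemma shift_chi:
  assumes "phase_matrices k n lam" "i \<in> {1..k}" "s \<in> {1..n i}" "\<alpha> \<in> tuples k n"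
  shows "shift k n lam i s (chi \<alpha>) = lam_coeff lam i s \<alpha> *\<^sub>C chi (\<alpha>(i := s # \<alpha> i))"
  using assms by (simp add: shift_eq_wcomp wcomp_single inj_on_prepend cmod_lam_coeff)

lemma tensor_id_shift:
  assumes "phase_matrices k n lam" "i \<in> {1..k}" "s \<in> {1..n i}"
  shows "bounded_clinear (tensor_id (shift k n lam i s) :: (_, 'a::chilbert_space) ell2 \<Rightarrow> _)"
    and "tensor_id (shift k n lam i s) (tensor_vec f x) =
      tensor_vec (shift k n lam i s f) (x :: 'a::chilbert_space)"
  using assms by (simp_all add: shift_eq_wcomp tensor_id_wcomp bounded_clinear_wcomp
      wcomp_tensor_vec inj_on_prepend cmod_lam_coeff)


section \<open>Polyballs\<close>

text \<open>
  A tuple is a function \<open>T\<close> with \<open>T i s\<close> the operator \<open>T\<^bsub>i,s\<^esub>\<close>; only its values for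
  \<open>i \<in> {1..k}\<close>, \<open>s \<in> {1..n i}\<close> matter.
\<close>

definition op_tuple :: "nat \<Rightarrow> (nat \<Rightarrow> nat) \<Rightarrow> (nat \<Rightarrow> nat \<Rightarrow> 'h::chilbert_space \<Rightarrow> 'h) \<Rightarrow> bool"
  where "op_tuple k n T \<longleftrightarrow> (\<forall>i\<in>{1..k}. \<forall>s\<in>{1..n i}. bounded_clinear (T i s))"

definition row_contraction :: "nat \<Rightarrow> (nat \<Rightarrow> 'h::chilbert_space \<Rightarrow> 'h) \<Rightarrow> bool"
  where "row_contraction m A \<longleftrightarrow> positive_op (\<lambda>x. x - (\<Sum>s=1..m. A s (cadjoint (A s) x)))"

definition commuting_row_contractions ::
    "nat \<Rightarrow> (nat \<Rightarrow> nat) \<Rightarrow> (nat \<Rightarrow> nat \<Rightarrow> nat \<Rightarrow> nat \<Rightarrow> complex) \<Rightarrow> (nat \<Rightarrow> nat \<Rightarrow> 'h::chilbert_space \<Rightarrow> 'h) set"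
  where "commuting_row_contractions k n lam = {T. op_tuple k n T
    \<and> (\<forall>i\<in>{1..k}. row_contraction (n i) (T i))
    \<and> (\<forall>i\<in>{1..k}. \<forall>j\<in>{1..k}. i \<noteq> j \<longrightarrow> (\<forall>s\<in>{1..n i}. \<forall>t\<in>{1..n j}. \<forall>x.
        T i s (T j t x) = lam i j s t *\<^sub>C T j t (T i s x)))}"

definition doubly_commuting_row_contractions ::
    "nat \<Rightarrow> (nat \<Rightarrow> nat) \<Rightarrow> (nat \<Rightarrow> nat \<Rightarrow> nat \<Rightarrow> nat \<Rightarrow> complex) \<Rightarrow> (nat \<Rightarrow> nat \<Rightarrow> 'h::chilbert_space \<Rightarrow> 'h) set"
  where "doubly_commuting_row_contractions k n lam = {T \<in> commuting_row_contractions k n lam.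
    \<forall>i\<in>{1..k}. \<forall>j\<in>{1..k}. i \<noteq> j \<longrightarrow> (\<forall>s\<in>{1..n i}. \<forall>t\<in>{1..n j}. \<forall>x.
        cadjoint (T i s) (T j t x) = cnj (lam i j s t) *\<^sub>C T j t (cadjoint (T i s) x))}"

text \<open>\<open>Phi r m A\<close> is the map \<open>\<Phi>\<^bsub>rA\<^esub>\<close> for a row \<open>A\<close> of length \<open>m\<close>.\<close>

definition Phi ::
    "real \<Rightarrow> nat \<Rightarrow> (nat \<Rightarrow> 'h::chilbert_space \<Rightarrow> 'h) \<Rightarrow> ('h \<Rightarrow> 'h) \<Rightarrow> 'h \<Rightarrow> 'h"
  where "Phi r m A Y = (\<lambda>x. \<Sum>s=1..m. r\<^sup>2 *\<^sub>R A s (Y (cadjoint (A s) x)))"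

definition defect ::
    "real \<Rightarrow> nat \<Rightarrow> (nat \<Rightarrow> nat) \<Rightarrow> (nat \<Rightarrow> nat \<Rightarrow> 'h::chilbert_space \<Rightarrow> 'h) \<Rightarrow> 'h \<Rightarrow> 'h"
  where "defect r k n T = foldr (\<lambda>i Y x. Y x - Phi r (n i) (T i) Y x) [1..<Suc k] id"

definition regular_polyball ::
    "nat \<Rightarrow> (nat \<Rightarrow> nat) \<Rightarrow> (nat \<Rightarrow> nat \<Rightarrow> nat \<Rightarrow> nat \<Rightarrow> complex) \<Rightarrow> (nat \<Rightarrow> nat \<Rightarrow> 'h::chilbert_space \<Rightarrow> 'h) set"
  where "regular_polyball k n lam = {T \<in> commuting_row_contractions k n lam.
    \<forall>r. 0 \<le> r \<and> r < 1 \<longrightarrow> positive_op (defect r k n T)}"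

definition pure_tuple :: "nat \<Rightarrow> (nat \<Rightarrow> nat) \<Rightarrow> (nat \<Rightarrow> nat \<Rightarrow> 'h::chilbert_space \<Rightarrow> 'h) \<Rightarrow> bool"
  where "pure_tuple k n T \<longleftrightarrow>
    (\<forall>i\<in>{1..k}. \<forall>x. (\<lambda>m. (Phi 1 (n i) (T i) ^^ m) id x) \<longlonglongrightarrow> 0)"

text \<open>
  \<open>shift_model k n lam T D V\<close>: the isometry \<open>V\<close> identifies the space on which \<open>T\<close> acts with a
  subspace of \<open>\<ell>\<^sup>2 \<otimes> D\<close> which is co-invariant under the operators \<open>S\<^bsub>i,s\<^esub> \<otimes> I\<close>, and under
  this identification \<open>T\<^bsub>i,s\<^esub>\<close> has as adjoint the restriction of the adjoint of
  \<open>S\<^bsub>i,s\<^esub> \<otimes> I\<close>.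
\<close>

definition shift_model ::
    "nat \<Rightarrow> (nat \<Rightarrow> nat) \<Rightarrow> (nat \<Rightarrow> nat \<Rightarrow> nat \<Rightarrow> nat \<Rightarrow> complex) \<Rightarrow> (nat \<Rightarrow> nat \<Rightarrow> 'h::chilbert_space \<Rightarrow> 'h)
      \<Rightarrow> 'd::chilbert_space set \<Rightarrow> ('h \<Rightarrow> (nat \<Rightarrow> nat list, 'd) ell2) \<Rightarrow> bool"
  where "shift_model k n lam T D V \<longleftrightarrow>
    cisometry V \<and> range V \<subseteq> ell2_on (tuples k n) D
    \<and> (\<forall>i\<in>{1..k}. \<forall>s\<in>{1..n i}. \<forall>f\<in>range V. cadjoint (tensor_id (shift k n lam i s)) f \<in> range V)
    \<and> (\<forall>i\<in>{1..k}. \<forall>s\<in>{1..n i}. \<forall>h.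
        V (cadjoint (T i s) h) = cadjoint (tensor_id (shift k n lam i s)) (V h))"

end

theory Submission
  imports Defs
begin

text \<open>
  Everything is expressed through the quadratic forms of the operators \<open>\<Phi>\<close>, which only involve the
  adjoints \<open>T\<^bsub>i,s\<^esub>\<^sup>*\<close> and are therefore transported by an isometry with co-invariant range.  For the
  shifts these forms are weighted sums of squared coefficients: \<open>\<Phi>\<^bsub>i\<^esub>\<^sup>m\<close> restricts to the tuples
  whose \<open>i\<close>-th word has length at least \<open>m\<close>, and the defect gets the weight
  \<open>\<Prod> (1 - r\<^sup>2)\<close> over the nonempty words, whence purity and regularity of every compression.

  Conversely, letting \<open>r\<close> tend to 1 gives a positive defect \<open>\<Delta>\<close>, and with \<open>W\<^sup>* W = \<Delta>\<close> the model map
  is \<open>h \<mapsto> (W T\<^bsub>\<alpha>\<^esub>\<^sup>* h)\<^bsub>\<alpha>\<^esub>\<close> with \<open>T\<^bsub>\<alpha>\<^esub> = T\<^bsub>1,\<alpha>\<^sub>1\<^esub> \<cdots> T\<^bsub>k,\<alpha>\<^sub>k\<^esub>\<close>; moving \<open>T\<^bsub>i,s\<^esub>\<close> into the \<open>i\<close>-th word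
  produces exactly the phase in the definition of the shifts.  It is isometric because the sum of
  the forms \<open>\<langle>\<Delta> T\<^bsub>\<alpha>\<^esub>\<^sup>* h, T\<^bsub>\<alpha>\<^esub>\<^sup>* h\<rangle>\<close> telescopes and \<open>T\<close> is pure.  Finally the compression of
  \<open>S\<^bsub>i,s\<^esub>\<^sup>* S\<^bsub>j,t\<^esub>\<close> is a phase times \<open>T\<^bsub>j,t\<^esub> T\<^bsub>i,s\<^esub>\<^sup>*\<close> because the shifts are doubly commuting.
\<close>

section \<open>Operators on Hilbert spaces\<close>

text \<open>The representing vector is found as the minimizer of \<open>J\<close>: if
  \<open>\<phi> x = inner x y\<close>, then \<open>J x\<close> is the squared distance from
  \<open>x\<close> to \<open>y\<close> up to a constant. Completeness enters through a minimizing
  sequence, which the parallelogram law makes Cauchy.\<close>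

lemma riesz_inner:
  fixes \<phi> :: "'a::{real_inner,complete_space} \<Rightarrow> real"
  assumes "bounded_linear \<phi>"
  shows "\<exists>y. \<forall>x. \<phi> x = inner x y"
proof -
  interpret bounded_linear \<phi> by fact
  obtain K where K: "\<And>x. norm (\<phi> x) \<le> norm x * K"
    using bounded by blast
  define J where "J x = (norm x)\<^sup>2 - 2 * \<phi> x" for x
  have J_ge: "J x \<ge> - K\<^sup>2" for x
  proof -
    have "0 \<le> (norm x - K)\<^sup>2" by simp
    moreover have "\<phi> x \<le> norm x * K" using K[of x] by simp
    ultimately show ?thesis by (simp add: J_def power2_diff)
  qed
  define I where "I = (INF x. J x)"
  have bdd: "bdd_below (range J)" by (rule bdd_belowI2[OF J_ge])
  have I_le: "I \<le> J x" for x unfolding I_def by (rule cINF_lower[OF bdd]) simp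
  \<comment> \<open>Parallelogram law, with the value of \<open>J\<close> at the midpoint bounded
    below by \<open>I\<close>.\<close>
  have par: "(norm (x - y))\<^sup>2 \<le> 2 * (J x - I) + 2 * (J y - I)" for x y
  proof -
    have "(norm ((1/2) *\<^sub>R (x + y)))\<^sup>2 = (norm (x + y))\<^sup>2 / 4"
      unfolding norm_scaleR by (simp add: power_divide)
    then have "4 * J ((1/2) *\<^sub>R (x + y)) = (norm (x + y))\<^sup>2 - 4 * \<phi> x - 4 * \<phi> y"
      by (simp add: J_def scaleR add field_simps del: scaleR_add_right)
    moreover have "(norm (x + y))\<^sup>2 + (norm (x - y))\<^sup>2 = 2 * (norm x)\<^sup>2 + 2 * (norm y)\<^sup>2"
      by (simp add: power2_norm_eq_inner inner_add_left inner_add_right inner_diff_left inner_diff_right)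
    ultimately have "(norm (x - y))\<^sup>2 = 2 * J x + 2 * J y - 4 * J ((1/2) *\<^sub>R (x + y))"
      by (simp add: J_def)
    then show ?thesis using I_le[of "(1/2) *\<^sub>R (x + y)"] by simp
  qed
  have "\<exists>x. J x < I + 1 / real (Suc m)" for m
    using cINF_less_iff[OF _ bdd, of "I + 1 / real (Suc m)"] by (simp add: I_def)
  then obtain X where X: "\<And>m. J (X m) < I + 1 / real (Suc m)" by metis
  have "Cauchy X"
  proof (rule CauchyI)
    fix e :: real assume e: "e > 0"
    obtain M where M: "inverse (real (Suc M)) < e\<^sup>2 / 4"
      using reals_Archimedean[of "e\<^sup>2 / 4"] e by auto
    have J: "4 * (J (X m) - I) < e\<^sup>2" if "m \<ge> M" for m
    proof -
      have "1 / real (Suc m) \<le> 1 / real (Suc M)" using that by (simp add: frac_le)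
      then show ?thesis using X[of m] M by (simp add: inverse_eq_divide)
    qed
    have "norm (X m - X p) < e" if "m \<ge> M" "p \<ge> M" for m p
    proof -
      have "(norm (X m - X p))\<^sup>2 < e\<^sup>2"
        using par[of "X m" "X p"] J[OF that(1)] J[OF that(2)] by linarith
      then show ?thesis using e by (simp add: power2_less_imp_less)
    qed
    then show "\<exists>M. \<forall>m\<ge>M. \<forall>n\<ge>M. norm (X m - X n) < e" by blast
  qed
  then obtain y where y: "X \<longlonglongrightarrow> y" using Cauchy_convergent convergent_def by blast
  have "(\<lambda>m. J (X m)) \<longlonglongrightarrow> J y"
    unfolding J_def by (intro tendsto_intros tendsto y)
  moreover have "(\<lambda>m. I + 1 / real (Suc m)) \<longlonglongrightarrow> I + 0"
    by (intro tendsto_intros LIMSEQ_Suc[OF lim_1_over_n])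
  ultimately have "J y \<le> I"
    using X by (intro LIMSEQ_le[of "\<lambda>m. J (X m)" "J y"]) (auto intro: less_imp_le)
  then have min: "J y \<le> J z" for z using I_le[of z] by simp
  have "\<phi> x = inner x y" for x
  proof -
    \<comment> \<open>\<open>2 * b\<close> is the derivative of \<open>J\<close> at \<open>y\<close>
      in direction \<open>x\<close>; it has to vanish at a minimum.\<close>
    define b where "b = inner x y - \<phi> x"
    have ge: "0 \<le> 2 * t * b + t\<^sup>2 * (norm x)\<^sup>2" for t
    proof -
      have "(norm (y + t *\<^sub>R x))\<^sup>2 = (norm y)\<^sup>2 + 2 * t * inner x y + t\<^sup>2 * (norm x)\<^sup>2"
        unfolding power2_norm_eq_inner
        by (simp add: inner_add_left inner_add_right inner_commute[of y x] power2_eq_square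
            algebra_simps)
      then show ?thesis
        using min[of "y + t *\<^sub>R x"] by (simp add: J_def b_def add scaleR algebra_simps)
    qed
    show ?thesis
    proof (cases "x = 0")
      case True
      then show ?thesis by (simp add: zero)
    next
      case False
      \<comment> \<open>The chosen \<open>t\<close> minimizes the quadratic polynomial of
        \<open>ge\<close>.\<close>
      have "0 \<le> 2 * (- b / (norm x)\<^sup>2) * b + (- b / (norm x)\<^sup>2)\<^sup>2 * (norm x)\<^sup>2" by (rule ge)
      also have "\<dots> = - b\<^sup>2 / (norm x)\<^sup>2"
        using False by (simp add: field_simps power2_eq_square)
      finally have "b\<^sup>2 \<le> 0" using False by (simp add: field_simps)
      then show ?thesis by (simp add: b_def)
    qed
  qed
  then show ?thesis by blast
qed

section \<open>Complex inner products and adjoints\<close>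

lemma cinner_zero [simp]: "cinner 0 x = 0" "cinner x 0 = (0 :: complex)"
  for x :: "'a::chilbert_space"
  using cinner_scaleC_left[of 0 0 x] cinner_scaleC_right[of x 0 0] by simp_all

lemma cinner_minus_left: "cinner (- x) y = - cinner x (y :: 'a::chilbert_space)"
  using cinner_add_left[of x "- x" y] by (simp add: eq_neg_iff_add_eq_0 add.commute)

lemma cinner_diff_left: "cinner (x - y) z = cinner x z - cinner y (z :: 'a::chilbert_space)"
  using cinner_add_left[of x "- y" z] by (simp add: cinner_minus_left)

lemma cinner_diff_right: "cinner z (x - y) = cinner z x - cinner z (y :: 'a::chilbert_space)"
  using cinner_diff_left[of x y z] by (metis cinner_commute complex_cnj_diff)

lemma cinner_sum_left: "cinner (sum f F) y = (\<Sum>i\<in>F. cinner (f i) (y :: 'a::chilbert_space))"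
  by (induction F rule: infinite_finite_induct) (auto simp: cinner_add_left)

lemma cinner_eqI:
  assumes "\<And>z. cinner z x = cinner z (y :: 'a::chilbert_space)"
  shows "x = y"
proof -
  have "cinner (x - y) (x - y) = 0" using assms by (simp add: cinner_diff_right)
  then show ?thesis by (simp add: cinner_self)
qed

lemma clinear_scaleR:
  assumes "clinear A"
  shows "A (r *\<^sub>R x) = r *\<^sub>R A x"
  by (simp add: scaleR_scaleC clinear_simps[OF assms])

text \<open>The real Riesz theorem represents the real part of \<open>\<phi>\<close>; evaluating at
  \<open>\<i> *\<^sub>C x\<close> turns the imaginary part into a real one, so the same vector
  represents it too.\<close>

lemma riesz_cinner:
  fixes \<phi> :: "'a::chilbert_space \<Rightarrow> complex"
  assumes "clinear \<phi>" and "\<And>x. cmod (\<phi> x) \<le> K * norm x"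
  shows "\<exists>y. \<forall>x. \<phi> x = cinner x y"
proof -
  have lin: "\<phi> (x + y) = \<phi> x + \<phi> y" "\<phi> (r *\<^sub>R x) = r *\<^sub>R \<phi> x" "\<phi> (c *\<^sub>C x) = c * \<phi> x" for x y r c
    using clinear_simps[OF assms(1)] clinear_scaleR[OF assms(1)] by (simp_all add: scaleC_complex_def)
  have "bounded_linear (\<lambda>x. Re (\<phi> x))"
  proof (rule bounded_linear_intro[where K = K])
    show "norm (Re (\<phi> x)) \<le> norm x * K" for x
      using abs_Re_le_cmod[of "\<phi> x"] assms(2)[of x] by (simp add: mult.commute)
  qed (simp_all add: lin)
  from riesz_inner[OF this] obtain y where y: "\<And>x. Re (\<phi> x) = Re (cinner x y)"
    by (auto simp: inner_eq_Re_cinner)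
  have "\<phi> x = cinner x y" for x
  proof (rule complex_eqI[OF y])
    have "Re (\<phi> (\<i> *\<^sub>C x)) = Re (cinner (\<i> *\<^sub>C x) y)" by (rule y)
    then show "Im (\<phi> x) = Im (cinner x y)" by (simp add: lin cinner_scaleC_left)
  qed
  then show ?thesis by blast
qed

text \<open>\<open>cadjoint\<close> is a definite description: existence comes from the Riesz
  theorem applied for each \<open>y\<close>, uniqueness from nondegeneracy of the inner
  product.\<close>

lemma cinner_cadjoint:
  fixes A :: "'a::chilbert_space \<Rightarrow> 'b::chilbert_space"
  assumes "bounded_clinear A"
  shows "cinner (A x) y = cinner x (cadjoint A y)"
proof -
  obtain K where K: "clinear A" "\<And>x. norm (A x) \<le> K * norm x"
    using assms unfolding bounded_clinear_def by blast
  have "\<exists>z. \<forall>x. cinner (A x) y = cinner x z" for y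
  proof (rule riesz_cinner)
    show "clinear (\<lambda>x. cinner (A x) y)"
      using K(1) by (simp add: clinear_def cinner_add_left cinner_scaleC_left scaleC_complex_def)
    show "cmod (cinner (A x) y) \<le> (K * norm y) * norm x" for x
    proof -
      have "cmod (cinner (A x) y) \<le> norm (A x) * norm y" by (rule cinner_Cauchy_Schwarz)
      also have "\<dots> \<le> K * norm x * norm y" by (intro mult_right_mono K(2)) simp
      finally show ?thesis by (simp only: mult_ac)
    qed
  qed
  then obtain B where B: "\<And>x y. cinner (A x) y = cinner x (B y)"
    using choice[of "\<lambda>y z. \<forall>x. cinner (A x) y = cinner x z"] by blast
  have "cadjoint A = B"
    unfolding cadjoint_def
  proof (rule the_equality)
    fix B' assume "\<forall>x y. cinner (A x) y = cinner x (B' y)"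
    then have "cinner x (B' y) = cinner x (B y)" for x y using B[of x y] by simp
    then show "B' = B" by (rule ext[OF cinner_eqI])
  qed (use B in blast)
  then show ?thesis using B by simp
qed

lemma cinner_cadjoint_right:
  assumes "bounded_clinear A"
  shows "cinner x (A y) = cinner (cadjoint A x) y"
  using arg_cong[OF cinner_cadjoint[OF assms, of y x], of cnj] by (simp only: cinner_commute[symmetric])

lemma clinear_cadjoint:
  assumes "bounded_clinear A"
  shows "clinear (cadjoint A)"
  unfolding clinear_def
proof (intro conjI allI)
  show "cadjoint A (x + y) = cadjoint A x + cadjoint A y" for x y
    by (rule cinner_eqI) (simp add: cinner_cadjoint[OF assms, symmetric] cinner_add_right)
  show "cadjoint A (c *\<^sub>C x) = c *\<^sub>C cadjoint A x" for c x
    by (rule cinner_eqI) (simp add: cinner_cadjoint[OF assms, symmetric] cinner_scaleC_right)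
qed

section \<open>Isometries and the projections onto their ranges\<close>

lemma isometry_cinner:
  assumes "cisometry V"
  shows "cinner (V x) (V y) = cinner x y"
proof -
  have V: "clinear V" "\<And>x. norm (V x) = norm x" using assms by (auto simp: cisometry_def)
  have Re: "Re (cinner (V x) (V y)) = Re (cinner x y)" for x y
  proof -
    \<comment> \<open>Polarization: the real inner product is expressed through norms, which
      \<open>V\<close> preserves.\<close>
    have "inner (V x) (V y) = ((norm (V (x + y)))\<^sup>2 - (norm (V x))\<^sup>2 - (norm (V y))\<^sup>2) / 2"
      by (simp add: clinear_simps[OF V(1)] power2_norm_eq_inner inner_simps inner_commute)
    also have "\<dots> = inner x y"
      unfolding V(2) by (simp add: power2_norm_eq_inner inner_simps inner_commute)
    finally show ?thesis by (simp add: inner_eq_Re_cinner)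
  qed
  show ?thesis
  proof (rule complex_eqI[OF Re])
    have "Re (cinner (V (\<i> *\<^sub>C x)) (V y)) = Re (cinner (\<i> *\<^sub>C x) y)" by (rule Re)
    then show "Im (cinner (V x) (V y)) = Im (cinner x y)"
      by (simp add: clinear_simps[OF V(1)] cinner_scaleC_left)
  qed
qed

lemma isometry_bounded: "cisometry V \<Longrightarrow> bounded_clinear V"
  by (auto simp: cisometry_def bounded_clinear_def intro!: exI[of _ 1])

lemma isometry_cadjoint:
  assumes "cisometry V"
  shows "cadjoint V (V x) = x"
  by (rule cinner_eqI)
    (simp add: cinner_cadjoint[OF isometry_bounded[OF assms], symmetric] isometry_cinner[OF assms])

text \<open>\<open>V V*\<close> is the projection: since \<open>V\<close> preserves inner products,
  the residual is orthogonal to the range, and since \<open>V* V = 1\<close>, any other candidate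
  \<open>V u\<close> has \<open>u = V* f\<close>.\<close>

lemma orth_proj_range_isometry:
  assumes "cisometry V"
  shows "orth_proj (range V) f = V (cadjoint V f)"
  unfolding orth_proj_def
proof (rule the_equality)
  note bdd = isometry_bounded[OF assms]
  have *: "cinner (f - V (cadjoint V f)) (V z) = 0" for z
    unfolding cinner_diff_left isometry_cinner[OF assms] by (simp add: cinner_cadjoint_right[OF bdd])
  then show "V (cadjoint V f) \<in> range V \<and> (\<forall>z\<in>range V. cinner (f - V (cadjoint V f)) z = 0)"
    by auto
  fix y assume y: "y \<in> range V \<and> (\<forall>z\<in>range V. cinner (f - y) z = 0)"
  then obtain u where u: "y = V u" by blast
  have "cinner (cadjoint V f - u) z = 0" for z
    using y unfolding u
    by (auto simp: cinner_diff_left cinner_cadjoint_right[OF bdd] isometry_cadjoint[OF assms])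
  then have "cinner (cadjoint V f - u) (cadjoint V f - u) = 0" by blast
  then show "y = V (cadjoint V f)" by (simp add: cinner_self u)
qed

lemma isometry_inj: "cisometry V \<Longrightarrow> inj V"
proof (rule injI)
  fix x y assume V: "cisometry V" "V x = V y"
  then have lin: "clinear V" by (simp add: cisometry_def)
  have "norm (V (x - y)) = 0" by (simp add: clinear_simps[OF lin] V(2))
  with V(1) show "x = y" by (simp add: cisometry_def)
qed

text \<open>This is \<open>P^2 <= P\<close> for \<open>0 <= P <= 1\<close>: test positivity at
  \<open>x - P x\<close> and the upper bound at \<open>P x\<close>.\<close>

lemma positive_contraction_norm:
  assumes "clinear P" and sym: "\<And>x y. cinner (P x) y = cinner x (P y)"
    and pos: "\<And>x. 0 \<le> Re (cinner (P x) x)" and le: "\<And>x. Re (cinner (P x) x) \<le> (norm x)\<^sup>2"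
  shows "(norm (P x))\<^sup>2 \<le> Re (cinner (P x) x)"
proof -
  have n: "Re (cinner y y) = (norm y)\<^sup>2" for y :: 'a by (simp add: cinner_self)
  have "0 \<le> Re (cinner (P (x - P x)) (x - P x))" by (rule pos)
  also have "\<dots> = Re (cinner (P x) x) - 2 * (norm (P x))\<^sup>2 + Re (cinner (P (P x)) (P x))"
    using sym[of "P x" x] by (simp add: clinear_simps[OF assms(1)] cinner_diff_left cinner_diff_right n)
  also have "\<dots> \<le> Re (cinner (P x) x) - (norm (P x))\<^sup>2"
    using le[of "P x"] by simp
  finally show ?thesis by simp
qed

section \<open>Square roots of positive contractions\<close>

text \<open>Makes absolutely convergent series of vectors converge, as the operator binomial series
  below requires.\<close>

instance chilbert_space \<subseteq> banach ..

text \<open>The Taylor coefficients of \<open>sqrt (1 - x)\<close> at 0.\<close>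

definition sqrt_coeff :: "nat \<Rightarrow> real"
  where "sqrt_coeff m = (1 / 2 gchoose m) * (- 1) ^ m"

lemma gchoose_Suc: "(a gchoose Suc m) = (a - real m) * (a gchoose m) / real (Suc m)"
  using gbinomial_mult_1[of a m] by (simp add: field_simps)

text \<open>The coefficient of index 1 is -1/2, and from there on the ratio of consecutive
  coefficients is positive.\<close>

lemma sqrt_coeff_nonpos: "sqrt_coeff (Suc m) \<le> 0"
proof (induction m)
  case (Suc m)
  have "sqrt_coeff (Suc (Suc m)) = sqrt_coeff (Suc m) * ((real (Suc m) - 1 / 2) / real (Suc (Suc m)))"
    unfolding sqrt_coeff_def gchoose_Suc[of _ "Suc m"] by (simp add: field_simps)
  also have "\<dots> \<le> 0"
    by (rule mult_nonpos_nonneg[OF Suc]) simp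
  finally show ?case .
qed (simp add: sqrt_coeff_def)

text \<open>Partial sums are the Taylor coefficients of \<open>sqrt (1 - x) / (1 - x)\<close>, the
  power -1/2 of \<open>1 - x\<close>; these start at 1 and have positive ratios.\<close>

lemma sum_sqrt_coeff_nonneg: "0 \<le> (\<Sum>j\<le>m. sqrt_coeff j)"
proof -
  have "0 \<le> (- 1) ^ m * (- 1 / 2 gchoose m :: real)"
  proof (induction m)
    case (Suc m)
    have "(- 1) ^ Suc m * (- 1 / 2 gchoose Suc m :: real) =
        ((- 1) ^ m * (- 1 / 2 gchoose m)) * ((1 / 2 + real m) / real (Suc m))"
      unfolding gchoose_Suc by (simp add: field_simps)
    also have "\<dots> \<ge> 0"
      by (rule mult_nonneg_nonneg[OF Suc]) simp
    finally show ?case .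
  qed simp
  then show ?thesis
    using gbinomial_sum_lower_neg[of "1 / 2 :: real" m] by (simp add: sqrt_coeff_def)
qed

text \<open>Only the constant coefficient 1 is positive, so a partial sum of absolute values plus
  the signed partial sum is 2; the signed one is nonnegative.\<close>

lemma summable_abs_sqrt_coeff: "summable (\<lambda>m. \<bar>sqrt_coeff m\<bar>)"
proof (rule bounded_imp_summable)
  fix m
  have "(\<Sum>j\<le>m. \<bar>sqrt_coeff j\<bar>) + (\<Sum>j\<le>m. sqrt_coeff j) \<le> 2"
  proof (induction m)
    case (Suc m)
    then show ?case using sqrt_coeff_nonpos[of m] by simp
  qed (simp add: sqrt_coeff_def)
  then show "(\<Sum>j\<le>m. \<bar>sqrt_coeff j\<bar>) \<le> 2"
    using sum_sqrt_coeff_nonneg[of m] by linarith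
qed simp

text \<open>Vandermonde's identity with \<open>1/2 + 1/2 = 1\<close>; it says coefficientwise that
  the series squares to \<open>1 - x\<close>.\<close>

lemma sqrt_coeff_convolution:
  "(\<Sum>j\<le>m. sqrt_coeff j * sqrt_coeff (m - j)) = (if m = 0 then 1 else if m = 1 then -1 else 0)"
proof -
  have "(\<Sum>j\<le>m. sqrt_coeff j * sqrt_coeff (m - j))
      = (\<Sum>j\<le>m. (1 / 2 gchoose j) * (1 / 2 gchoose (m - j)) * (- 1) ^ m)"
  proof (rule sum.cong)
    fix j assume "j \<in> {..m}"
    then have "(- 1 :: real) ^ j * (- 1) ^ (m - j) = (- 1) ^ m"
      by (simp add: power_add[symmetric])
    from this[symmetric] show "sqrt_coeff j * sqrt_coeff (m - j)
        = (1 / 2 gchoose j) * (1 / 2 gchoose (m - j)) * (- 1) ^ m"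
      by (simp add: sqrt_coeff_def)
  qed simp
  also have "\<dots> = (1 gchoose m) * (- 1) ^ m"
    using gbinomial_Vandermonde[of "1 / 2 :: real" "1 / 2" m]
    by (simp add: sum_distrib_right[symmetric] atMost_atLeast0)
  also have "(1 gchoose m :: real) = of_nat (1 choose m)"
    by (simp add: binomial_gbinomial)
  finally show ?thesis
    by (cases m; cases "m - 1") auto
qed

text \<open>Makes inner products of series terms depend only on the sum of the exponents, which is
  what a Cauchy product needs.\<close>

lemma selfadjoint_funpow:
  assumes "\<And>x y. cinner (A x) y = cinner x (A y)"
  shows "cinner ((A ^^ m) x) ((A ^^ l) y) = cinner ((A ^^ (l + m)) x) y"
proof (induction l arbitrary: y)
  case (Suc l)
  have "cinner ((A ^^ m) x) ((A ^^ Suc l) y) = cinner ((A ^^ (l + m)) x) (A y)"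
    using Suc[of "A y"] by (simp add: funpow_swap1)
  then show ?case by (simp add: assms)
qed simp

lemma clinear_funpow:
  fixes A :: "'a::chilbert_space \<Rightarrow> 'a"
  assumes "clinear A"
  shows "clinear (A ^^ m)"
  by (induction m) (use assms in \<open>auto simp: clinear_def\<close>)

text \<open>
  The square root of \<open>1 - A\<close> is given by the binomial series; the identity for its norm is the
  Cauchy product of that series with itself.
\<close>

lemma positive_contraction_sqrt:
  fixes P :: "'a::chilbert_space \<Rightarrow> 'a"
  assumes lin: "clinear P" and sym: "\<And>x y. cinner (P x) y = cinner x (P y)"
    and pos: "\<And>x. 0 \<le> Re (cinner (P x) x)" and le: "\<And>x. Re (cinner (P x) x) \<le> (norm x)\<^sup>2"
  shows "\<exists>W :: 'a \<Rightarrow> 'a. clinear W \<and> (\<forall>x. (norm (W x))\<^sup>2 = Re (cinner (P x) x))"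
proof -
  define A where "A x = x - P x" for x
  define c where "c = sqrt_coeff"
  have Alin: "clinear A"
  proof -
    have "d *\<^sub>C (x - y) = d *\<^sub>C x - d *\<^sub>C y" for d and x y :: 'a
      using scaleC_add_right[of d "x - y" y] by simp
    then show ?thesis
      using lin by (simp add: clinear_def A_def)
  qed
  have Asym: "cinner (A x) y = cinner x (A y)" for x y
    by (simp add: A_def cinner_diff_left cinner_diff_right sym)
  have ReA: "Re (cinner (A x) x) = (norm x)\<^sup>2 - Re (cinner (P x) x)" for x
    by (simp add: A_def cinner_diff_left cinner_self)
  \<comment> \<open>\<open>A = 1 - P\<close> is again a positive contraction, hence
    \<open>A^2 <= A <= 1\<close>.\<close>
  have Anorm: "norm (A x) \<le> norm x" for x
  proof (rule power2_le_imp_le)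
    have "(norm (A x))\<^sup>2 \<le> Re (cinner (A x) x)"
      by (rule positive_contraction_norm[OF Alin Asym]) (use pos le ReA in auto)
    then show "(norm (A x))\<^sup>2 \<le> (norm x)\<^sup>2" using ReA[of x] pos[of x] by linarith
  qed simp
  have An: "norm ((A ^^ m) x) \<le> norm x" for m x
    by (induction m) (auto intro: order_trans[OF Anorm])
  define u where "u x m = c m *\<^sub>R (A ^^ m) x" for x m
  have su: "summable (\<lambda>m. norm (u x m))" for x
  proof (rule summable_comparison_test')
    show "summable (\<lambda>m. \<bar>c m\<bar> * norm x)"
      unfolding c_def by (intro summable_mult2 summable_abs_sqrt_coeff)
    show "norm (norm (u x m)) \<le> \<bar>c m\<bar> * norm x" if "m \<ge> 0" for m
      by (simp add: u_def An mult_left_mono)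
  qed
  define W where "W x = (\<Sum>m. u x m)" for x
  have uW: "(u x) sums W x" for x
    unfolding W_def by (rule summable_sums[OF summable_norm_cancel[OF su]])
  have hW: "(u x has_sum W x) UNIV" for x
    by (rule norm_summable_imp_has_sum[OF su uW])
  have "clinear W"
    unfolding clinear_def
  proof (intro conjI allI)
    fix x y :: 'a and d :: complex
    note f = clinear_simps[OF clinear_funpow[OF Alin]]
    have "u (x + y) = (\<lambda>m. u x m + u y m)"
      by (simp add: u_def f scaleR_add_right fun_eq_iff)
    then show "W (x + y) = W x + W y"
      using sums_unique2[OF uW[of "x + y"]] sums_add[OF uW[of x] uW[of y]] by simp
    have bl: "bounded_linear (\<lambda>z :: 'a. d *\<^sub>C z)"
      by (rule bounded_linear_intro[where K = "cmod d"])
        (simp_all add: scaleC_add_right scaleR_scaleC scaleC_scaleC norm_scaleC mult.commute)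
    have "u (d *\<^sub>C x) = (\<lambda>m. d *\<^sub>C u x m)"
      by (simp add: u_def f scaleR_scaleC scaleC_scaleC fun_eq_iff mult.commute)
    then show "W (d *\<^sub>C x) = d *\<^sub>C W x"
      using sums_unique2[OF uW[of "d *\<^sub>C x"]] bounded_linear.sums[OF bl uW[of x]] by simp
  qed
  moreover have "(norm (W x))\<^sup>2 = Re (cinner (P x) x)" for x
  proof -
    define a where "a m = inner ((A ^^ m) x) x" for m
    have inner_u: "inner (u x m) (u x l) = c m * c l * a (m + l)" for m l
      using selfadjoint_funpow[of A m x l x, OF Asym]
      by (simp add: u_def a_def inner_eq_Re_cinner scaleR_scaleC cinner_scaleC_left
          cinner_scaleC_right add.commute)
    define f where "f = (\<lambda>(m, l). c m * c l * a (m + l))"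
    have row: "((\<lambda>l. f (m, l)) has_sum inner (u x m) (W x)) UNIV" for m
      using has_sum_bounded_linear[OF bounded_linear_inner_right hW, of "u x m" x]
      by (simp add: f_def inner_u o_def)
    have rows: "((\<lambda>m. inner (u x m) (W x)) has_sum inner (W x) (W x)) UNIV"
      using has_sum_bounded_linear[OF bounded_linear_inner_left hW, of x "W x"]
      by (simp add: o_def)
    have cs: "(\<lambda>m. norm (c m)) summable_on UNIV"
      unfolding c_def using summable_abs_sqrt_coeff
      by (intro norm_summable_imp_summable_on) simp
    \<comment> \<open>Absolutely summable majorant of the double family \<open>f\<close>; it
      justifies every rearrangement below.\<close>
    have cc: "(\<lambda>p. norm ((\<lambda>(m, l). c m * (c l * (norm x)\<^sup>2)) p)) summable_on UNIV \<times> UNIV"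
      unfolding Infinite_Sum.abs_summable_on_Sigma_iff
      using cs by (auto simp: abs_mult infsum_cmult_right' infsum_cmult_left'
          intro!: summable_on_cmult_left summable_on_cmult_right)
    have f_summable: "f summable_on UNIV \<times> UNIV"
    proof (rule abs_summable_summable, rule Infinite_Sum.abs_summable_on_comparison_test[OF cc])
      fix p :: "nat \<times> nat"
      have "\<bar>a m\<bar> \<le> (norm x)\<^sup>2" for m
        using Cauchy_Schwarz_ineq2[of "(A ^^ m) x" x] mult_right_mono[OF An[of m x], of "norm x"]
        by (simp add: a_def power2_eq_square)
      then show "norm (f p) \<le> norm ((\<lambda>(m, l). c m * (c l * (norm x)\<^sup>2)) p)"
        by (cases p) (simp add: f_def abs_mult mult_left_mono mult.assoc)
    qed
    have "inner (W x) (W x) = infsum f (UNIV \<times> UNIV)"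
      using infsum_Sigma_banach[OF f_summable] infsumI[OF row] infsumI[OF rows] by simp
    \<comment> \<open>Regroup along the antidiagonals, where the exponent sum \<open>m\<close> is
      constant.\<close>
    also have "\<dots> = infsum (\<lambda>p. f ((\<lambda>(m, j). (j, m - j)) p)) (SIGMA m:UNIV. {..m})"
    proof (rule infsum_reindex_bij_betw[symmetric])
      show "bij_betw (\<lambda>(m, j). (j, m - j)) (SIGMA m:UNIV. {..m}) (UNIV \<times> (UNIV :: nat set))"
        by (rule bij_betwI[where g = "\<lambda>(j, l). (j + l, j)"]) auto
    qed
    also have "\<dots> = infsum (\<lambda>m. infsum (\<lambda>j. f (j, m - j)) {..m}) UNIV"
    proof -
      have "(\<lambda>p. f ((\<lambda>(m, j). (j, m - j)) p)) summable_on (SIGMA m:UNIV. {..m})"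
        using f_summable
        by (subst summable_on_reindex_bij_betw[where B = "UNIV \<times> UNIV"])
          (auto intro!: bij_betwI[where g = "\<lambda>(j, l). (j + l, j)"])
      from infsum_Sigma_banach[OF this] show ?thesis by simp
    qed
    also have "\<dots> = infsum (\<lambda>m. (if m = 0 then 1 else if m = 1 then -1 else 0) * a m) UNIV"
      unfolding sqrt_coeff_convolution[symmetric]
      by (rule infsum_cong) (simp add: f_def c_def sum_distrib_right)
    \<comment> \<open>Only the antidiagonals 0 and 1 survive, leaving the form of
      \<open>1 - A = P\<close>.\<close>
    also have "\<dots> = (\<Sum>m\<in>{0, 1}. (if m = 0 then 1 else if m = 1 then -1 else 0) * a m)"
      by (subst infsum_finite[symmetric], simp) (rule infsum_cong_neutral, auto)
    also have "\<dots> = Re (cinner (P x) x)"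
      by (simp add: a_def inner_eq_Re_cinner A_def cinner_diff_left)
    finally show ?thesis by (simp add: power2_norm_eq_inner)
  qed
  ultimately show ?thesis by blast
qed

section \<open>Quadratic forms of polyball operators\<close>

abbreviation norm_sq :: "'a::chilbert_space \<Rightarrow> real"
  where "norm_sq x \<equiv> (norm x)\<^sup>2"

text \<open>
  If \<open>q\<close> is the quadratic form of \<open>Y\<close> and \<open>B s\<close> the adjoint of \<open>A s\<close>, then \<open>form_map m B q\<close> is the
  quadratic form of \<open>Phi 1 m A Y\<close>.  Such forms only see the adjoints, which is why they can be
  compared along a co-invariant embedding.
\<close>

definition form_map :: "nat \<Rightarrow> (nat \<Rightarrow> 'a \<Rightarrow> 'a) \<Rightarrow> ('a \<Rightarrow> real) \<Rightarrow> 'a \<Rightarrow> real"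
  where "form_map m B q x = (\<Sum>s=1..m. q (B s x))"

text \<open>For \<open>q = norm_sq\<close> this is the form of a partial product of the factors
  \<open>id - Phi\<close>. The list \<open>L\<close> is a parameter so that inductions can run along
  the \<open>foldr\<close> of \<open>defect\<close>.\<close>

definition defect_form ::
    "real \<Rightarrow> nat list \<Rightarrow> (nat \<Rightarrow> nat) \<Rightarrow> (nat \<Rightarrow> nat \<Rightarrow> 'a \<Rightarrow> 'a) \<Rightarrow> ('a \<Rightarrow> real) \<Rightarrow> 'a \<Rightarrow> real"
  where "defect_form r L n B =
    foldr (\<lambda>i q x. q x - r\<^sup>2 * form_map (n i) (B i) q x) L"

lemma defect_form_Nil [simp]: "defect_form r [] n B q = q"
  by (simp add: defect_form_def)

lemma defect_form_Cons [simp]: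
  "defect_form r (i # L) n B q x =
    defect_form r L n B q x - r\<^sup>2 * form_map (n i) (B i) (defect_form r L n B q) x"
  by (simp add: defect_form_def)

lemma form_map_mono: "(\<And>x. q x \<le> q' x) \<Longrightarrow> form_map m B q x \<le> form_map m B q' x"
  unfolding form_map_def by (intro sum_mono) simp

lemma form_map_nonneg: "(\<And>x. 0 \<le> q x) \<Longrightarrow> 0 \<le> form_map m B q x"
  unfolding form_map_def by (intro sum_nonneg) simp

lemma form_map_diff: "form_map m B (\<lambda>x. q x - q' x) x = form_map m B q x - form_map m B q' x"
  by (simp add: form_map_def sum_subtractf)

lemma form_map_cmult: "form_map m B (\<lambda>x. c * q x) x = c * form_map m B q x"
  by (simp add: form_map_def sum_distrib_left)

lemma form_map_sum: "form_map m B (\<lambda>x. \<Sum>j\<in>J. q j x) x = (\<Sum>j\<in>J. form_map m B (q j) x)"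
  unfolding form_map_def by (rule sum.swap)

section \<open>Transport, bounds and limits of forms\<close>

lemma form_map_intertwine:
  assumes "\<And>s. s \<in> {1..m} \<Longrightarrow> V (A s h) = B s (V h)" and "\<And>h. q h = q' (V h)"
  shows "form_map m A q h = form_map m B q' (V h)"
  unfolding form_map_def by (rule sum.cong) (use assms in auto)

lemma form_map_funpow_intertwine:
  assumes "\<And>s h. s \<in> {1..m} \<Longrightarrow> V (A s h) = B s (V h)" and "\<And>h. q h = q' (V h)"
  shows "(form_map m A ^^ l) q h = (form_map m B ^^ l) q' (V h)"
proof (induction l arbitrary: h)
  case (Suc l)
  show ?case
    by (simp, rule form_map_intertwine[where V = V and q' = "(form_map m B ^^ l) q'"])
      (use assms(1) Suc in auto)
qed (simp add: assms(2))

lemma defect_form_intertwine: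
  assumes "\<And>i s h. i \<in> set L \<Longrightarrow> s \<in> {1..n i} \<Longrightarrow> V (A i s h) = B i s (V h)"
    and "\<And>h. q h = q' (V h)"
  shows "defect_form r L n A q h = defect_form r L n B q' (V h)"
  using assms(1)
proof (induction L arbitrary: h)
  case (Cons i L)
  have IH: "defect_form r L n A q h = defect_form r L n B q' (V h)" for h
    by (rule Cons.IH) (use Cons.prems in auto)
  have "form_map (n i) (A i) (defect_form r L n A q) h
      = form_map (n i) (B i) (defect_form r L n B q') (V h)"
    by (rule form_map_intertwine[where V = V]) (use Cons.prems IH in auto)
  then show ?case by (simp add: IH)
qed (simp add: assms(2))

lemma form_map_funpow_le:
  assumes "\<And>x. form_map m B q x \<le> q x"
  shows "(form_map m B ^^ l) q x \<le> q x"
proof (induction l arbitrary: x)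
  case (Suc l)
  have "(form_map m B ^^ Suc l) q x \<le> form_map m B q x"
    by (simp add: form_map_mono Suc)
  then show ?case using assms[of x] by linarith
qed simp

lemma form_map_funpow_nonneg:
  assumes "\<And>x. 0 \<le> q x"
  shows "0 \<le> (form_map m B ^^ l) q x"
  by (induction l arbitrary: x) (auto simp: assms form_map_nonneg)

lemma continuous_defect_form: "continuous_on UNIV (\<lambda>r. defect_form r L n B q x)"
proof (induction L arbitrary: x)
  case (Cons i L)
  show ?case
    unfolding defect_form_Cons form_map_def
    by (intro continuous_on_diff continuous_on_mult continuous_on_sum continuous_on_power
        continuous_on_id Cons)
qed simp

text \<open>For fixed \<open>x\<close> the form is continuous in \<open>r\<close>, so positivity
  passes to the left limit at 1.\<close>

lemma defect_form_one_nonneg: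
  assumes "\<And>r. 0 \<le> r \<Longrightarrow> r < 1 \<Longrightarrow> 0 \<le> defect_form r L n B q x"
  shows "0 \<le> defect_form 1 L n B q x"
proof (rule tendsto_lowerbound)
  have "((\<lambda>r. defect_form r L n B q x) \<longlongrightarrow> defect_form 1 L n B q x) (at 1)"
    using continuous_defect_form[of L n B q x] by (simp add: continuous_on_def)
  then show "((\<lambda>r. defect_form r L n B q x) \<longlongrightarrow> defect_form 1 L n B q x) (at_left 1)"
    by (rule tendsto_within_subset) simp
  show "\<forall>\<^sub>F r in at_left 1. 0 \<le> defect_form r L n B q x"
    using eventually_at_left_real[of 0 1] by (rule eventually_mono) (auto intro: assms)
qed simp

section \<open>Operators and their quadratic forms\<close>

lemma cinner_Phi:
  assumes "\<forall>s\<in>{1..m}. bounded_clinear (A s)"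
  shows "cinner (Phi r m A Y x) y = (\<Sum>s=1..m. (complex_of_real r)\<^sup>2 * cinner (Y (cadjoint (A s) x)) (cadjoint (A s) y))"
  unfolding Phi_def cinner_sum_left
  by (rule sum.cong) (use assms in \<open>auto simp: scaleR_scaleC cinner_scaleC_left cinner_cadjoint\<close>)

lemma cinner_Phi_form:
  assumes "\<forall>s\<in>{1..m}. bounded_clinear (A s)"
    and "\<And>x. cinner (Y x) x = complex_of_real (q x)"
  shows "cinner (Phi r m A Y x) x = complex_of_real (r\<^sup>2 * form_map m (\<lambda>s. cadjoint (A s)) q x)"
  by (simp add: cinner_Phi[OF assms(1)] assms(2) form_map_def sum_distrib_left)

lemma Phi_selfadjoint:
  assumes "\<forall>s\<in>{1..m}. bounded_clinear (A s)"
    and "\<And>x y. cinner (Y x) y = cinner x (Y y)"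
  shows "cinner (Phi r m A Y x) y = cinner x (Phi r m A Y y)"
proof -
  have "cinner x (Phi r m A Y y) = cnj (cinner (Phi r m A Y y) x)"
    by (rule cinner_commute)
  also have "\<dots> = (\<Sum>s=1..m. (complex_of_real r)\<^sup>2 * cnj (cinner (Y (cadjoint (A s) y)) (cadjoint (A s) x)))"
    by (simp add: cinner_Phi[OF assms(1)])
  also have "\<dots> = cinner (Phi r m A Y x) y"
    unfolding cinner_Phi[OF assms(1)] cinner_commute[symmetric] assms(2) ..
  finally show ?thesis by simp
qed

lemma clinear_Phi:
  assumes "\<forall>s\<in>{1..m}. bounded_clinear (A s)" and "clinear Y"
  shows "clinear (Phi r m A Y)"
proof -
  have summand: "clinear (\<lambda>x. r\<^sup>2 *\<^sub>R A s (Y (cadjoint (A s) x)))" if "s \<in> {1..m}" for s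
  proof -
    note lin = clinear_cadjoint[OF bspec[OF assms(1) that]] assms(2)
    have A: "clinear (A s)" using bspec[OF assms(1) that] by (simp add: bounded_clinear_def)
    show ?thesis
      unfolding clinear_def
      by (simp add: clinear_simps[OF lin(1)] clinear_simps[OF lin(2)] clinear_simps[OF A]
          scaleR_add_right) (simp add: scaleR_scaleC scaleC_scaleC mult.commute)
  qed
  have sum: "clinear (\<lambda>x. \<Sum>s\<in>F. f s x)" if "finite F" "\<And>s. s \<in> F \<Longrightarrow> clinear (f s)"
    for F :: "nat set" and f :: "nat \<Rightarrow> 'a \<Rightarrow> 'a"
    using that by (induction F rule: finite_induct) (auto simp: clinear_def scaleC_add_right)
  show ?thesis unfolding Phi_def by (rule sum[OF finite_atLeastAtMost summand])
qed

text \<open>The three properties run through the \<open>foldr\<close> together. Linearity and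
  symmetry are what taking the square root of the defect requires; the third turns operator
  positivity into positivity of forms.\<close>

lemma defect_fold:
  fixes r :: real
  assumes "\<forall>i\<in>set L. \<forall>s\<in>{1..n i}. bounded_clinear (T i s)"
  defines "Y \<equiv> foldr (\<lambda>i Y x. Y x - Phi r (n i) (T i) Y x) L id"
  shows "clinear Y" and "cinner (Y x) y = cinner x (Y y)"
    and "cinner (Y x) x = complex_of_real (defect_form r L n (\<lambda>i s. cadjoint (T i s)) norm_sq x)"
proof -
  have "clinear Y \<and> (\<forall>x y. cinner (Y x) y = cinner x (Y y)) \<and>
      (\<forall>x. cinner (Y x) x = complex_of_real (defect_form r L n (\<lambda>i s. cadjoint (T i s)) norm_sq x))"
    unfolding Y_def using assms(1)
  proof (induction L)
    case Nil
    then show ?case by (simp add: clinear_def cinner_self)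
  next
    case (Cons i L)
    define Z where "Z = foldr (\<lambda>i Y x. Y x - Phi r (n i) (T i) Y x) L id"
    have T: "\<forall>s\<in>{1..n i}. bounded_clinear (T i s)" using Cons.prems by simp
    have L: "\<forall>i\<in>set L. \<forall>s\<in>{1..n i}. bounded_clinear (T i s)" using Cons.prems by simp
    have Z: "clinear Z" "\<And>x y. cinner (Z x) y = cinner x (Z y)"
      "\<And>x. cinner (Z x) x = complex_of_real (defect_form r L n (\<lambda>i s. cadjoint (T i s)) norm_sq x)"
      using Cons.IH[OF L] unfolding Z_def[symmetric] by blast+
    have diff: "c *\<^sub>C (x - y) = c *\<^sub>C x - c *\<^sub>C y" for c and x y :: 'a
      using scaleC_add_right[of c "x - y" y] by simp
    have a: "clinear (\<lambda>x. Z x - Phi r (n i) (T i) Z x)"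
      using Z(1) clinear_Phi[OF T Z(1), of r] by (simp add: clinear_def diff)
    have b: "cinner (Z x - Phi r (n i) (T i) Z x) y = cinner x (Z y - Phi r (n i) (T i) Z y)"
      for x y
      unfolding cinner_diff_left cinner_diff_right Z(2) Phi_selfadjoint[OF T Z(2)] ..
    have c: "cinner (Z x - Phi r (n i) (T i) Z x) x =
        complex_of_real (defect_form r (i # L) n (\<lambda>i s. cadjoint (T i s)) norm_sq x)" for x
      unfolding cinner_diff_left Z(3) cinner_Phi_form[OF T Z(3)] by simp
    have fold: "foldr (\<lambda>i Y x. Y x - Phi r (n i) (T i) Y x) (i # L) id
        = (\<lambda>x. Z x - Phi r (n i) (T i) Z x)"
      unfolding foldr_Cons o_apply Z_def ..
    show ?case unfolding fold using a b c by blast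
  qed
  then show "clinear Y" "cinner (Y x) y = cinner x (Y y)"
    "cinner (Y x) x = complex_of_real (defect_form r L n (\<lambda>i s. cadjoint (T i s)) norm_sq x)"
    by blast+
qed

lemma cinner_defect:
  assumes "op_tuple k n T"
  shows "cinner (defect r k n T x) x =
    complex_of_real (defect_form r [1..<Suc k] n (\<lambda>i s. cadjoint (T i s)) norm_sq x)"
  unfolding defect_def by (rule defect_fold(3)) (use assms in \<open>auto simp: op_tuple_def\<close>)

lemma positive_defect_iff:
  assumes "op_tuple k n T"
  shows "positive_op (defect r k n T) \<longleftrightarrow>
    (\<forall>x. 0 \<le> defect_form r [1..<Suc k] n (\<lambda>i s. cadjoint (T i s)) norm_sq x)"
  by (simp add: positive_op_def cinner_defect[OF assms] less_eq_complex_def del: upt_Suc)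

lemma row_contraction_iff:
  assumes "\<forall>s\<in>{1..m}. bounded_clinear (A s)"
  shows "row_contraction m A \<longleftrightarrow> (\<forall>x. form_map m (\<lambda>s. cadjoint (A s)) norm_sq x \<le> norm_sq x)"
proof -
  have "cinner (x - (\<Sum>s=1..m. A s (cadjoint (A s) x))) x =
      complex_of_real (norm_sq x - form_map m (\<lambda>s. cadjoint (A s)) norm_sq x)" for x
    using cinner_Phi_form[OF assms, where Y = id and q = norm_sq and r = 1 and x = x]
    by (simp add: cinner_diff_left cinner_self Phi_def)
  then show ?thesis by (simp add: row_contraction_def positive_op_def less_eq_complex_def)
qed

lemma Phi_funpow:
  assumes "\<forall>s\<in>{1..m}. bounded_clinear (A s)"
  shows "clinear ((Phi 1 m A ^^ l) id)"
    and "cinner ((Phi 1 m A ^^ l) id x) y = cinner x ((Phi 1 m A ^^ l) id y)"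
    and "cinner ((Phi 1 m A ^^ l) id x) x =
      complex_of_real ((form_map m (\<lambda>s. cadjoint (A s)) ^^ l) norm_sq x)"
proof -
  show "clinear ((Phi 1 m A ^^ l) id)"
    by (induction l) (use clinear_Phi[OF assms] in \<open>auto simp: clinear_def\<close>)
  show "cinner ((Phi 1 m A ^^ l) id x) y = cinner x ((Phi 1 m A ^^ l) id y)"
  proof (induction l arbitrary: x y)
    case (Suc l)
    show ?case using Phi_selfadjoint[OF assms Suc] by simp
  qed simp
  show "cinner ((Phi 1 m A ^^ l) id x) x =
      complex_of_real ((form_map m (\<lambda>s. cadjoint (A s)) ^^ l) norm_sq x)"
  proof (induction l arbitrary: x)
    case (Suc l)
    show ?case using cinner_Phi_form[OF assms Suc, of 1] by simp
  qed (simp add: cinner_self)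
qed

text \<open>Strong convergence gives convergence of the forms by pairing with \<open>x\<close>.
  Conversely the iterates are positive contractions, and for these the squared norm is bounded by
  the form.\<close>

lemma pure_row_iff:
  assumes A: "\<forall>s\<in>{1..m}. bounded_clinear (A s)" and row: "row_contraction m A"
  shows "(\<lambda>l. (Phi 1 m A ^^ l) id x) \<longlonglongrightarrow> 0 \<longleftrightarrow>
    (\<lambda>l. (form_map m (\<lambda>s. cadjoint (A s)) ^^ l) norm_sq x) \<longlonglongrightarrow> 0"
    (is "?P \<longlonglongrightarrow> 0 \<longleftrightarrow> ?q \<longlonglongrightarrow> 0")
proof
  have Re: "Re (cinner ((Phi 1 m A ^^ l) id x) x)
      = (form_map m (\<lambda>s. cadjoint (A s)) ^^ l) norm_sq x" for l x
    by (simp add: Phi_funpow(3)[OF A])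
  show "?q \<longlonglongrightarrow> 0" if "?P \<longlonglongrightarrow> 0"
  proof -
    have "(\<lambda>l. inner (?P l) x) \<longlonglongrightarrow> inner 0 x" by (intro tendsto_intros that)
    then show ?thesis by (simp only: inner_eq_Re_cinner Re) simp
  qed
  have le: "norm_sq (?P l) \<le> ?q l" for l
    unfolding Re[symmetric]
  proof (rule positive_contraction_norm[OF Phi_funpow(1,2)[OF A]])
    fix x
    show "0 \<le> Re (cinner ((Phi 1 m A ^^ l) id x) x)"
      unfolding Re by (rule form_map_funpow_nonneg) simp
    show "Re (cinner ((Phi 1 m A ^^ l) id x) x) \<le> norm_sq x"
      unfolding Re using row by (intro form_map_funpow_le) (simp add: row_contraction_iff[OF A])
  qed
  show "?P \<longlonglongrightarrow> 0" if "?q \<longlonglongrightarrow> 0"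
  proof -
    have "(\<lambda>l. norm_sq (?P l)) \<longlonglongrightarrow> 0"
      by (rule tendsto_sandwich[OF _ _ tendsto_const that]) (use le in auto)
    from tendsto_real_sqrt[OF this] show ?thesis by (simp add: tendsto_norm_zero_iff)
  qed
qed

lemma pure_tuple_iff:
  assumes "op_tuple k n T" and "\<forall>i\<in>{1..k}. row_contraction (n i) (T i)"
  shows "pure_tuple k n T \<longleftrightarrow>
    (\<forall>i\<in>{1..k}. \<forall>x. (\<lambda>l. (form_map (n i) (\<lambda>s. cadjoint (T i s)) ^^ l) norm_sq x) \<longlonglongrightarrow> 0)"
  unfolding pure_tuple_def
  by (rule ball_cong[OF refl], rule all_cong1, rule pure_row_iff)
    (use assms in \<open>auto simp: op_tuple_def\<close>)

text \<open>Moves commutation relations to the adjoints, the operators that a co-invariant embedding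
  transports.\<close>

lemma cadjoint_commutation_iff:
  assumes "bounded_clinear A" "bounded_clinear B"
  shows "(\<forall>x. A (B x) = c *\<^sub>C B (A x)) \<longleftrightarrow>
    (\<forall>x. cadjoint B (cadjoint A x) = cnj c *\<^sub>C cadjoint A (cadjoint B x))"
proof
  note r = cinner_cadjoint_right[OF assms(1)] cinner_cadjoint_right[OF assms(2)]
  note l = cinner_cadjoint[OF assms(1), symmetric] cinner_cadjoint[OF assms(2), symmetric]
  show "\<forall>x. cadjoint B (cadjoint A x) = cnj c *\<^sub>C cadjoint A (cadjoint B x)"
    if "\<forall>x. A (B x) = c *\<^sub>C B (A x)"
  proof
    fix x
    show "cadjoint B (cadjoint A x) = cnj c *\<^sub>C cadjoint A (cadjoint B x)"
      by (rule cinner_eqI) (simp add: l cinner_scaleC_right that cinner_scaleC_left)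
  qed
  show "\<forall>x. A (B x) = c *\<^sub>C B (A x)"
    if "\<forall>x. cadjoint B (cadjoint A x) = cnj c *\<^sub>C cadjoint A (cadjoint B x)"
  proof
    fix x
    show "A (B x) = c *\<^sub>C B (A x)"
      by (rule cinner_eqI) (simp add: r cinner_scaleC_right that cinner_scaleC_left)
  qed
qed

section \<open>The standard shifts and their adjoints\<close>

lemma cinner_ell2_single: "cinner (ell2_single i x) g = cinner x (ell2_nth g i)"
proof -
  have "cinner (ell2_single i x) g = infsum (\<lambda>j. cinner (ell2_nth (ell2_single i x) j) (ell2_nth g j)) {i}"
    unfolding cinner_ell2_def by (rule infsum_cong_neutral) (auto simp: ell2_single.rep_eq)
  then show ?thesis by (simp add: ell2_single.rep_eq)
qed

text \<open>Pairing with a vector supported at the single index \<open>i\<close> reads off one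
  coordinate of the adjoint.\<close>

lemma ell2_nth_cadjoint_wcomp:
  fixes g :: "('j, 'a::chilbert_space) ell2"
  assumes "inj_on \<sigma> X" "\<forall>i\<in>X. cmod (c i) = 1"
  shows "ell2_nth (cadjoint (wcomp X \<sigma> c) g) i = (if i \<in> X then cnj (c i) *\<^sub>C ell2_nth g (\<sigma> i) else 0)"
proof (rule cinner_eqI)
  fix z :: 'a
  have "cinner z (ell2_nth (cadjoint (wcomp X \<sigma> c) g) i) = cinner (wcomp X \<sigma> c (ell2_single i z)) g"
    by (simp add: cinner_ell2_single cinner_cadjoint[OF bounded_clinear_wcomp[OF assms]])
  also have "\<dots> = cinner z (if i \<in> X then cnj (c i) *\<^sub>C ell2_nth g (\<sigma> i) else 0)"
    by (simp add: wcomp_single[OF assms] cinner_scaleC_left cinner_scaleC_right cinner_ell2_single)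
  finally show "cinner z (ell2_nth (cadjoint (wcomp X \<sigma> c) g) i) = \<dots>" .
qed

lemma tuples_push:
  assumes "\<alpha> \<in> tuples k n" "i \<in> {1..k}" "s \<in> {1..n i}"
  shows "\<alpha>(i := s # \<alpha> i) \<in> tuples k n"
  using assms by (auto simp: tuples_def PiE_iff extensional_def)

text \<open>The coefficient for position \<open>i\<close> involves only the words before it, so a
  letter added at \<open>j\<close> contributes its phase exactly when \<open>j < i\<close>.\<close>

lemma lam_coeff_push:
  assumes "1 \<le> j" "j \<noteq> i"
  shows "lam_coeff lam i s (\<alpha>(j := t # \<alpha> j)) = (if j < i then lam i j s t else 1) * lam_coeff lam i s \<alpha>"
proof (cases "j < i")
  case True
  then have j: "j \<in> {1..<i}" using assms by simp
  have "(\<Prod>l\<in>{1..<i} - {j}. lam_word lam i l s ((\<alpha>(j := t # \<alpha> j)) l))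
      = (\<Prod>l\<in>{1..<i} - {j}. lam_word lam i l s (\<alpha> l))"
    by (rule prod.cong) auto
  then show ?thesis
    using True unfolding lam_coeff_def prod.remove[OF finite_atLeastLessThan j]
    by (simp add: lam_word_def mult.assoc)
next
  case False
  then have "lam_word lam i l s ((\<alpha>(j := t # \<alpha> j)) l) = lam_word lam i l s (\<alpha> l)" if "l \<in> {1..<i}" for l
    using that by auto
  then show ?thesis using False by (simp add: lam_coeff_def)
qed

section \<open>Phase relations of the shifts and their adjoints\<close>

locale phases =
  fixes k :: nat and n :: "nat \<Rightarrow> nat" and lam :: "nat \<Rightarrow> nat \<Rightarrow> nat \<Rightarrow> nat \<Rightarrow> complex"
  assumes phases: "phase_matrices k n lam"
begin

lemma lam_unimodular:
  assumes "i \<in> {1..k}" "j \<in> {1..k}" "i \<noteq> j" "s \<in> {1..n i}" "t \<in> {1..n j}"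
  shows "cmod (lam i j s t) = 1" "lam j i t s = cnj (lam i j s t)" "lam i j s t * cnj (lam i j s t) = 1"
proof -
  show *: "cmod (lam i j s t) = 1" "lam j i t s = cnj (lam i j s t)"
    using phases assms unfolding phase_matrices_def by blast+
  show "lam i j s t * cnj (lam i j s t) = 1"
    using complex_norm_square[of "lam i j s t"] * by simp
qed

text \<open>The scalar content of the commutation of two shifts. Only the later position sees the
  other letter: for \<open>j < i\<close> this produces \<open>lam i j s t\<close> on the left, for
  \<open>i < j\<close> it produces \<open>lam j i t s\<close> on the right, cancelling
  \<open>lam i j s t\<close>.\<close>

lemma lam_coeff_exchange:
  assumes "i \<in> {1..k}" "j \<in> {1..k}" "i \<noteq> j" "s \<in> {1..n i}" "t \<in> {1..n j}"
  shows "lam_coeff lam i s (\<alpha>(j := t # \<alpha> j)) * lam_coeff lam j t \<alpha> =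
    lam i j s t * lam_coeff lam j t (\<alpha>(i := s # \<alpha> i)) * lam_coeff lam i s \<alpha>"
proof -
  have "lam i j s t * lam j i t s = 1" using lam_unimodular[OF assms] by (simp add: mult.commute)
  then show ?thesis
    using assms by (cases "i < j") (simp_all add: lam_coeff_push)
qed

abbreviation shift_op :: "nat \<Rightarrow> nat \<Rightarrow> (nat \<Rightarrow> nat list, 'd::chilbert_space) ell2 \<Rightarrow> (nat \<Rightarrow> nat list, 'd) ell2"
  where "shift_op i s \<equiv> tensor_id (shift k n lam i s)"

abbreviation shift_adj :: "nat \<Rightarrow> nat \<Rightarrow> (nat \<Rightarrow> nat list, 'd::chilbert_space) ell2 \<Rightarrow> (nat \<Rightarrow> nat list, 'd) ell2"
  where "shift_adj i s \<equiv> cadjoint (shift_op i s)"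

lemma shift_op_eq:
  assumes "i \<in> {1..k}" "s \<in> {1..n i}"
  shows "shift_op i s = wcomp (tuples k n) (\<lambda>\<alpha>. \<alpha>(i := s # \<alpha> i)) (lam_coeff lam i s)"
  unfolding shift_eq_wcomp[OF phases assms]
  by (rule tensor_id_wcomp[OF inj_on_prepend]) (use cmod_lam_coeff[OF phases assms] in blast)

lemma ell2_nth_shift_adj:
  assumes "i \<in> {1..k}" "s \<in> {1..n i}"
  shows "ell2_nth (shift_adj i s f) \<alpha> =
    (if \<alpha> \<in> tuples k n then cnj (lam_coeff lam i s \<alpha>) *\<^sub>C ell2_nth f (\<alpha>(i := s # \<alpha> i)) else 0)"
  unfolding shift_op_eq[OF assms]
  by (rule ell2_nth_cadjoint_wcomp[OF inj_on_prepend]) (use cmod_lam_coeff[OF phases assms] in blast)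

lemma ell2_nth_shift_op:
  assumes "i \<in> {1..k}" "s \<in> {1..n i}"
  shows ell2_nth_shift_op_push: "\<alpha> \<in> tuples k n \<Longrightarrow>
      ell2_nth (shift_op i s f) (\<alpha>(i := s # \<alpha> i)) = lam_coeff lam i s \<alpha> *\<^sub>C ell2_nth f \<alpha>"
    and ell2_nth_shift_op_zero: "\<beta> \<notin> (\<lambda>\<alpha>. \<alpha>(i := s # \<alpha> i)) ` tuples k n \<Longrightarrow>
      ell2_nth (shift_op i s f) \<beta> = 0"
proof -
  have c: "\<forall>\<alpha>\<in>tuples k n. cmod (lam_coeff lam i s \<alpha>) = 1"
    using cmod_lam_coeff[OF phases assms] by blast
  note nth = ell2_nth_wcomp[OF inj_on_prepend c, of i s f, folded shift_op_eq[OF assms]]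
  show "ell2_nth (shift_op i s f) (\<alpha>(i := s # \<alpha> i)) = lam_coeff lam i s \<alpha> *\<^sub>C ell2_nth f \<alpha>"
    if "\<alpha> \<in> tuples k n"
    using inv_into_f_f[OF inj_on_prepend that, of i s] that by (simp add: nth)
  show "ell2_nth (shift_op i s f) \<beta> = 0" if "\<beta> \<notin> (\<lambda>\<alpha>. \<alpha>(i := s # \<alpha> i)) ` tuples k n"
    using that by (simp add: nth)
qed

lemma shift_adj_commute:
  assumes "i \<in> {1..k}" "j \<in> {1..k}" "i \<noteq> j" "s \<in> {1..n i}" "t \<in> {1..n j}"
  shows "shift_adj j t (shift_adj i s f) = cnj (lam i j s t) *\<^sub>C shift_adj i s (shift_adj j t f)"
proof (rule ell2_eqI)
  fix \<alpha> :: "nat \<Rightarrow> nat list"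
  show "ell2_nth (shift_adj j t (shift_adj i s f)) \<alpha> =
      ell2_nth (cnj (lam i j s t) *\<^sub>C shift_adj i s (shift_adj j t f)) \<alpha>"
    using arg_cong[OF lam_coeff_exchange[OF assms, of \<alpha>], of cnj] assms
      fun_upd_twist[OF assms(3), of \<alpha> "s # \<alpha> i" "t # \<alpha> j"]
    by (simp add: ell2_nth_shift_adj tuples_push scaleC_scaleC mult_ac)
qed

text \<open>At a tuple whose \<open>j\<close>-th word arises by prepending \<open>t\<close>, this is
  the conjugated exchange identity with two unimodular factors moved across; at all other tuples
  both sides vanish.\<close>

lemma shift_adj_shift_op:
  assumes "i \<in> {1..k}" "j \<in> {1..k}" "i \<noteq> j" "s \<in> {1..n i}" "t \<in> {1..n j}"
  shows "shift_adj i s (shift_op j t f) = cnj (lam i j s t) *\<^sub>C shift_op j t (shift_adj i s f)"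
proof (rule ell2_eqI)
  fix \<beta> :: "nat \<Rightarrow> nat list"
  let ?push = "\<lambda>\<alpha>. \<alpha>(j := t # \<alpha> j)"
  show "ell2_nth (shift_adj i s (shift_op j t f)) \<beta> =
      ell2_nth (cnj (lam i j s t) *\<^sub>C shift_op j t (shift_adj i s f)) \<beta>"
  proof (cases "\<beta> \<in> ?push ` tuples k n")
    case True
    then obtain \<alpha> where \<alpha>: "\<alpha> \<in> tuples k n" "\<beta> = ?push \<alpha>" by blast
    define a b c d where "a = lam_coeff lam i s (?push \<alpha>)" and "b = lam_coeff lam j t \<alpha>"
      and "c = lam_coeff lam j t (\<alpha>(i := s # \<alpha> i))" and "d = lam_coeff lam i s \<alpha>"
    have unit: "cnj b * b = 1" "cnj c * c = 1"
      using cmod_lam_coeff[OF phases assms(2,5) \<alpha>(1)]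
        cmod_lam_coeff[OF phases assms(2,5) tuples_push[OF \<alpha>(1) assms(1,4)]]
      by (metis b_def c_def complex_norm_square mult.commute of_real_1 power_one)+
    have "cnj a * cnj b = cnj (lam i j s t) * cnj c * cnj d"
      using arg_cong[OF lam_coeff_exchange[OF assms, of \<alpha>], of cnj]
      by (simp add: a_def b_def c_def d_def)
    \<comment> \<open>Multiplying by \<open>b * c\<close> cancels the unimodular \<open>b\<close> on
      the left and \<open>c\<close> on the right.\<close>
    then have "(cnj a * cnj b) * (b * c) = (cnj (lam i j s t) * cnj c * cnj d) * (b * c)"
      by simp
    then have "cnj a * c * (cnj b * b) = cnj (lam i j s t) * b * cnj d * (cnj c * c)"
      by (simp only: mult_ac)
    then have "cnj a * c = cnj (lam i j s t) * b * cnj d"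
      by (simp add: unit)
    moreover have "(?push \<alpha>)(i := s # ?push \<alpha> i) = ?push (\<alpha>(i := s # \<alpha> i))"
      using assms(3) by (simp add: fun_upd_twist)
    ultimately show ?thesis
      unfolding \<alpha>(2) a_def b_def c_def d_def
      using assms \<alpha>(1) ell2_nth_shift_op_push[OF assms(2,5) tuples_push[OF \<alpha>(1) assms(1,4)], of f]
      by (simp add: ell2_nth_shift_adj ell2_nth_shift_op_push tuples_push scaleC_scaleC mult.assoc)
  next
    case False
    \<comment> \<open>A letter added at \<open>i\<close> leaves the \<open>j\<close>-th word alone,
      so it cannot create the missing initial \<open>t\<close>.\<close>
    have "\<beta>(i := s # \<beta> i) \<notin> ?push ` tuples k n" if "\<beta> \<in> tuples k n"
    proof
      assume "\<beta>(i := s # \<beta> i) \<in> ?push ` tuples k n"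
      then obtain \<gamma> where \<gamma>: "\<gamma> \<in> tuples k n" "\<beta>(i := s # \<beta> i) = ?push \<gamma>" by blast
      have "\<beta> j = t # \<gamma> j"
        using fun_cong[OF \<gamma>(2), of j] assms(3) by simp
      then have "\<beta> = ?push (\<beta>(j := \<gamma> j))" by auto
      moreover have "\<beta>(j := \<gamma> j) \<in> tuples k n"
        using that \<gamma>(1) assms(2) by (auto simp: tuples_def PiE_iff extensional_def)
      ultimately show False using False by blast
    qed
    then show ?thesis
      using False assms by (simp add: ell2_nth_shift_adj ell2_nth_shift_op_zero)
  qed
qed

end

section \<open>Co-invariant subspaces of the shifts\<close>

definition weighted_sq :: "'i set \<Rightarrow> ('i \<Rightarrow> real) \<Rightarrow> ('i, 'a::chilbert_space) ell2 \<Rightarrow> real"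
  where "weighted_sq X w f = (\<Sum>\<^sub>\<infinity>\<alpha>\<in>X. w \<alpha> * (norm (ell2_nth f \<alpha>))\<^sup>2)"

lemma weighted_sq_summable:
  assumes "\<And>\<alpha>. \<bar>w \<alpha>\<bar> \<le> 1"
  shows "(\<lambda>\<alpha>. w \<alpha> * (norm (ell2_nth f \<alpha>))\<^sup>2) summable_on X"
proof (rule real_summable_comparison)
  show "(\<lambda>\<alpha>. (norm (ell2_nth f \<alpha>))\<^sup>2) summable_on X"
    by (rule summable_on_subset_banach[OF ell2_summable subset_UNIV])
  show "\<bar>w \<alpha> * (norm (ell2_nth f \<alpha>))\<^sup>2\<bar> \<le> (norm (ell2_nth f \<alpha>))\<^sup>2" for \<alpha>
    using assms[of \<alpha>] by (simp add: abs_mult mult_left_le_one_le)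
qed

lemma weighted_sq_mono:
  assumes "\<And>\<alpha>. \<bar>w \<alpha>\<bar> \<le> 1" "\<And>\<alpha>. \<bar>w' \<alpha>\<bar> \<le> 1" "\<And>\<alpha>. \<alpha> \<in> X \<Longrightarrow> w \<alpha> \<le> w' \<alpha>"
  shows "weighted_sq X w f \<le> weighted_sq X w' f"
  unfolding weighted_sq_def
  by (intro infsum_mono weighted_sq_summable assms(1,2)) (simp add: assms(3) mult_right_mono)

lemma weighted_sq_le: "weighted_sq X (\<lambda>_. 1) f \<le> (norm f)\<^sup>2"
  unfolding weighted_sq_def ell2_norm_sq
  by (rule infsum_mono_neutral)
    (auto intro!: ell2_summable summable_on_subset_banach[OF ell2_summable subset_UNIV])

lemma weighted_sq_nonneg: "(\<And>\<alpha>. 0 \<le> w \<alpha>) \<Longrightarrow> 0 \<le> weighted_sq X w f"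
  unfolding weighted_sq_def by (intro infsum_nonneg) simp

lemma weighted_sq_eq_norm:
  assumes "\<And>\<alpha>. \<alpha> \<notin> X \<Longrightarrow> ell2_nth f \<alpha> = 0"
  shows "weighted_sq X (\<lambda>_. 1) f = (norm f)\<^sup>2"
  unfolding weighted_sq_def ell2_norm_sq by (rule infsum_cong_neutral) (use assms in auto)

text \<open>Dominated convergence by hand: outside a finite index set \<open>f\<close> has squared
  norm below \<open>e\<close>, and on that set all weights vanish from some \<open>l\<close>
  on.\<close>

lemma weighted_sq_tendsto_0:
  assumes w: "\<And>l \<alpha>. 0 \<le> w l \<alpha>" "\<And>l \<alpha>. w l \<alpha> \<le> 1"
    and ev: "\<And>\<alpha>. eventually (\<lambda>l. w l \<alpha> = 0) sequentially"
  shows "(\<lambda>l. weighted_sq X (w l) f) \<longlonglongrightarrow> 0"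
proof (rule LIMSEQ_I)
  fix e :: real assume e: "0 < e"
  have "0 < sqrt e" using e by simp
  from ell2_approx[OF this, of f] obtain F where F: "finite F"
    "norm (f - (\<Sum>i\<in>F. ell2_single i (ell2_nth f i))) < sqrt e"
    by blast
  let ?g = "f - (\<Sum>i\<in>F. ell2_single i (ell2_nth f i))"
  have abs: "\<bar>w l \<alpha>\<bar> \<le> 1" for l \<alpha> using w by simp
  have "\<forall>\<^sub>F l in sequentially. \<forall>\<alpha>\<in>F. w l \<alpha> = 0"
    using F(1) ev by (simp add: eventually_ball_finite)
  then obtain N where N: "\<And>l \<alpha>. l \<ge> N \<Longrightarrow> \<alpha> \<in> F \<Longrightarrow> w l \<alpha> = 0"
    by (auto simp: eventually_sequentially)
  have "norm (weighted_sq X (w l) f - 0) < e" if "l \<ge> N" for l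
  proof -
    have "weighted_sq X (w l) f = weighted_sq X (w l) ?g"
      unfolding weighted_sq_def
      by (rule infsum_cong) (use N[OF that] F(1) in \<open>auto simp: ell2_nth_sum_single\<close>)
    also have "\<dots> \<le> weighted_sq X (\<lambda>_. 1) ?g"
      by (rule weighted_sq_mono) (use abs w in auto)
    also have "\<dots> \<le> (norm ?g)\<^sup>2" by (rule weighted_sq_le)
    also have "\<dots> < e"
      using power_strict_mono[OF F(2), of 2] e by simp
    finally show ?thesis using weighted_sq_nonneg[of "w l" X f] w by simp
  qed
  then show "\<exists>N. \<forall>l\<ge>N. norm (weighted_sq X (w l) f - 0) < e" by blast
qed

section \<open>Forms of the adjoints of the shifts\<close>

context phases
begin

abbreviation tuple_sq :: "((nat \<Rightarrow> nat list) \<Rightarrow> real) \<Rightarrow> (nat \<Rightarrow> nat list, 'd::chilbert_space) ell2 \<Rightarrow> real"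
  where "tuple_sq \<equiv> weighted_sq (tuples k n)"

text \<open>Up to a unimodular factor, the adjoint of a shift reads \<open>f\<close> at the tuple
  with \<open>s\<close> prepended. Prepending is a bijection from pairs of a letter and a tuple onto
  the tuples with nonempty \<open>i\<close>-th word, so the weight is pulled back along removal of
  the first letter.\<close>

lemma form_map_tuple_sq:
  assumes w: "\<And>\<alpha>. \<bar>w \<alpha>\<bar> \<le> 1" and i: "i \<in> {1..k}"
  shows "form_map (n i) (shift_adj i) (tuple_sq w) f =
    tuple_sq (\<lambda>\<alpha>. if \<alpha> i = [] then 0 else w (\<alpha>(i := tl (\<alpha> i)))) f"
proof -
  let ?push = "\<lambda>(s, \<alpha>). \<alpha>(i := s # \<alpha> i)"
  let ?g = "\<lambda>\<beta>. w (\<beta>(i := tl (\<beta> i))) * (norm (ell2_nth f \<beta>))\<^sup>2"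
  have bij: "bij_betw ?push ({1..n i} \<times> tuples k n) {\<beta> \<in> tuples k n. \<beta> i \<noteq> []}"
  proof (rule bij_betwI[where g = "\<lambda>\<beta>. (hd (\<beta> i), \<beta>(i := tl (\<beta> i)))"])
    show "?push \<in> {1..n i} \<times> tuples k n \<rightarrow> {\<beta> \<in> tuples k n. \<beta> i \<noteq> []}"
      using tuples_push i by auto
    show "(\<lambda>\<beta>. (hd (\<beta> i), \<beta>(i := tl (\<beta> i)))) \<in> {\<beta> \<in> tuples k n. \<beta> i \<noteq> []} \<rightarrow> {1..n i} \<times> tuples k n"
    proof
      fix \<beta> assume \<beta>: "\<beta> \<in> {\<beta> \<in> tuples k n. \<beta> i \<noteq> []}"
      then obtain s v where sv: "\<beta> i = s # v" by (cases "\<beta> i") auto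
      have "\<beta> i \<in> lists {1..n i}" using \<beta> i by (auto simp: tuples_def PiE_iff)
      then show "(hd (\<beta> i), \<beta>(i := tl (\<beta> i))) \<in> {1..n i} \<times> tuples k n"
        using \<beta> i sv by (auto simp: tuples_def PiE_iff extensional_def)
    qed
  qed auto
  have g: "?g summable_on A" for A
    by (rule weighted_sq_summable[where w = "\<lambda>\<beta>. w (\<beta>(i := tl (\<beta> i)))"]) (rule w)
  have "form_map (n i) (shift_adj i) (tuple_sq w) f
      = (\<Sum>s\<in>{1..n i}. \<Sum>\<^sub>\<infinity>\<alpha>\<in>tuples k n. ?g (?push (s, \<alpha>)))"
    unfolding form_map_def weighted_sq_def
  proof (intro sum.cong infsum_cong refl)
    fix s \<alpha> assume "s \<in> {1..n i}" and \<alpha>: "\<alpha> \<in> tuples k n"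
    then show "w \<alpha> * (norm (ell2_nth (shift_adj i s f) \<alpha>))\<^sup>2 = ?g (?push (s, \<alpha>))"
      using cmod_lam_coeff[OF phases i _ \<alpha>] i by (simp add: ell2_nth_shift_adj norm_scaleC)
  qed
  also have "\<dots> = infsum (\<lambda>p. ?g (?push p)) ({1..n i} \<times> tuples k n)"
    using infsum_Sigma_banach[of "\<lambda>p. ?g (?push p)" "{1..n i}" "\<lambda>_. tuples k n"]
      summable_on_reindex_bij_betw[OF bij, of ?g] g
    by simp
  also have "\<dots> = infsum ?g {\<beta> \<in> tuples k n. \<beta> i \<noteq> []}"
    by (rule infsum_reindex_bij_betw[OF bij])
  also have "\<dots> = tuple_sq (\<lambda>\<alpha>. if \<alpha> i = [] then 0 else w (\<alpha>(i := tl (\<alpha> i)))) f"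
    unfolding weighted_sq_def by (rule infsum_cong_neutral) auto
  finally show ?thesis .
qed

lemma form_map_funpow_tuple_sq:
  assumes "i \<in> {1..k}"
  shows "(form_map (n i) (shift_adj i) ^^ l) (tuple_sq (\<lambda>_. 1)) f =
    tuple_sq (\<lambda>\<alpha>. if l \<le> length (\<alpha> i) then 1 else 0) f"
proof (induction l arbitrary: f)
  case (Suc l)
  have "(form_map (n i) (shift_adj i) ^^ Suc l) (tuple_sq (\<lambda>_. 1)) f =
      form_map (n i) (shift_adj i) (tuple_sq (\<lambda>\<alpha>. if l \<le> length (\<alpha> i) then 1 else 0)) f"
    by (simp add: Suc[abs_def])
  also have "\<dots> = tuple_sq (\<lambda>\<alpha>. if \<alpha> i = [] then 0
      else if l \<le> length ((\<alpha>(i := tl (\<alpha> i))) i) then 1 else 0) f"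
    by (rule form_map_tuple_sq) (use assms in auto)
  also have "(\<lambda>\<alpha> :: nat \<Rightarrow> nat list. if \<alpha> i = [] then 0 else if l \<le> length ((\<alpha>(i := tl (\<alpha> i))) i) then 1 else 0 :: real)
      = (\<lambda>\<alpha>. if Suc l \<le> length (\<alpha> i) then 1 else 0)"
  proof
    fix \<alpha> :: "nat \<Rightarrow> nat list"
    show "(if \<alpha> i = [] then 0 else if l \<le> length ((\<alpha>(i := tl (\<alpha> i))) i) then 1 else 0 :: real)
        = (if Suc l \<le> length (\<alpha> i) then 1 else 0)"
      by (cases "\<alpha> i") auto
  qed
  finally show ?case .
qed simp

lemma defect_form_tuple_sq:
  fixes f :: "(nat \<Rightarrow> nat list, 'd::chilbert_space) ell2"
  assumes "distinct L" "set L \<subseteq> {1..k}" "\<bar>r\<bar> \<le> 1"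
  shows "defect_form r L n shift_adj (tuple_sq (\<lambda>_. 1)) f =
    tuple_sq (\<lambda>\<alpha>. \<Prod>i\<in>set L. if \<alpha> i = [] then 1 else 1 - r\<^sup>2) f"
  using assms(1,2)
proof (induction L arbitrary: f)
  case (Cons i L)
  define w where "w = (\<lambda>\<alpha> :: nat \<Rightarrow> nat list. \<Prod>j\<in>set L. if \<alpha> j = [] then 1 else 1 - r\<^sup>2)"
  have r: "0 \<le> r\<^sup>2" "r\<^sup>2 \<le> 1" using assms(3) by (simp_all add: abs_square_le_1)
  have w: "\<bar>w \<alpha>\<bar> \<le> 1" for \<alpha>
    unfolding w_def abs_prod by (rule prod_le_1) (use r in auto)
  \<comment> \<open>By distinctness \<open>i\<close> is not in \<open>L\<close>, so the weight of
    the other factors ignores the \<open>i\<close>-th word; the new factor then multiplies it by 1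
    or \<open>1 - r\<^sup>2\<close>.\<close>
  have w_tl: "w (\<alpha>(i := v)) = w \<alpha>" for \<alpha> v
    unfolding w_def by (rule prod.cong) (use Cons.prems in auto)
  have IH: "defect_form r L n shift_adj (tuple_sq (\<lambda>_. 1)) =
      (tuple_sq w :: (nat \<Rightarrow> nat list, 'd) ell2 \<Rightarrow> real)"
    unfolding w_def by (rule ext) (use Cons in simp)
  have "defect_form r (i # L) n shift_adj (tuple_sq (\<lambda>_. 1)) f
      = tuple_sq w f + (- r\<^sup>2) * tuple_sq (\<lambda>\<alpha>. if \<alpha> i = [] then 0 else w \<alpha>) f"
    unfolding defect_form_Cons IH
    using form_map_tuple_sq[where w = w and i = i and f = f] w Cons.prems
    by (simp add: w_tl cong: if_cong)
  also have "\<dots> = (\<Sum>\<^sub>\<infinity>\<alpha>\<in>tuples k n. w \<alpha> * (norm (ell2_nth f \<alpha>))\<^sup>2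
      + (- r\<^sup>2) * ((if \<alpha> i = [] then 0 else w \<alpha>) * (norm (ell2_nth f \<alpha>))\<^sup>2))"
    unfolding weighted_sq_def infsum_cmult_right'[symmetric]
    by (intro infsum_add[symmetric] summable_on_cmult_right weighted_sq_summable) (simp_all add: w)
  also have "\<dots> = tuple_sq (\<lambda>\<alpha>. \<Prod>j\<in>set (i # L). if \<alpha> j = [] then 1 else 1 - r\<^sup>2) f"
    unfolding weighted_sq_def
    by (rule infsum_cong) (use Cons.prems in \<open>auto simp: w_def algebra_simps\<close>)
  finally show ?case .
qed simp

section \<open>Tuples that have a shift model\<close>

lemma shift_model_adjoint:
  assumes "shift_model k n lam T D V" "i \<in> {1..k}" "s \<in> {1..n i}"
  shows "V (cadjoint (T i s) h) = shift_adj i s (V h)"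
  using assms by (auto simp: shift_model_def)

lemma shift_model_norm:
  assumes "shift_model k n lam T D V"
  shows "norm_sq h = tuple_sq (\<lambda>_. 1) (V h)"
proof -
  have V: "cisometry V" "V h \<in> ell2_on (tuples k n) D" using assms by (auto simp: shift_model_def)
  then have "tuple_sq (\<lambda>_. 1) (V h) = norm_sq (V h)"
    by (intro weighted_sq_eq_norm) (auto simp: ell2_on_def)
  then show ?thesis using V(1) by (simp add: cisometry_def)
qed

lemma shift_model_row_contraction:
  assumes T: "op_tuple k n T" and M: "shift_model k n lam T D V" and i: "i \<in> {1..k}"
  shows "row_contraction (n i) (T i)"
proof -
  have bdd: "\<forall>s\<in>{1..n i}. bounded_clinear (T i s)" using T i by (simp add: op_tuple_def)
  have "form_map (n i) (\<lambda>s. cadjoint (T i s)) norm_sq h \<le> norm_sq h" for h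
  proof -
    have "form_map (n i) (\<lambda>s. cadjoint (T i s)) norm_sq h
        = form_map (n i) (shift_adj i) (tuple_sq (\<lambda>_. 1)) (V h)"
      by (rule form_map_intertwine[where V = V])
        (use shift_model_adjoint[OF M i] shift_model_norm[OF M] in auto)
    also have "\<dots> = tuple_sq (\<lambda>\<alpha>. if \<alpha> i = [] then 0 else 1) (V h)"
      by (rule form_map_tuple_sq[OF _ i]) simp
    also have "\<dots> \<le> tuple_sq (\<lambda>_. 1) (V h)"
      by (rule weighted_sq_mono) auto
    finally show ?thesis by (simp add: shift_model_norm[OF M])
  qed
  then show ?thesis by (simp add: row_contraction_iff[OF bdd])
qed

lemma shift_model_pure:
  assumes T: "op_tuple k n T" and M: "shift_model k n lam T D V"
  shows "pure_tuple k n T"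
proof -
  have "(\<lambda>l. (form_map (n i) (\<lambda>s. cadjoint (T i s)) ^^ l) norm_sq h) \<longlonglongrightarrow> 0"
    if i: "i \<in> {1..k}" for i h
  proof -
    have "(form_map (n i) (\<lambda>s. cadjoint (T i s)) ^^ l) norm_sq h
        = tuple_sq (\<lambda>\<alpha>. if l \<le> length (\<alpha> i) then 1 else 0) (V h)" for l
      unfolding form_map_funpow_tuple_sq[OF i, symmetric]
      by (rule form_map_funpow_intertwine[where V = V])
        (use shift_model_adjoint[OF M i] shift_model_norm[OF M] in auto)
    moreover have "(\<lambda>l. tuple_sq (\<lambda>\<alpha>. if l \<le> length (\<alpha> i) then 1 else 0) (V h)) \<longlonglongrightarrow> 0"
    proof (rule weighted_sq_tendsto_0)
      fix \<alpha> :: "nat \<Rightarrow> nat list"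
      show "\<forall>\<^sub>F l in sequentially. (if l \<le> length (\<alpha> i) then 1 else 0) = (0 :: real)"
        using eventually_gt_at_top[of "length (\<alpha> i)"] by (rule eventually_mono) simp
    qed auto
    ultimately show ?thesis by simp
  qed
  then show ?thesis
    using pure_tuple_iff[OF T] shift_model_row_contraction[OF T M] by blast
qed

lemma shift_model_polyball:
  assumes T: "op_tuple k n T" and M: "shift_model k n lam T D V"
  shows "T \<in> regular_polyball k n lam"
proof -
  have V: "cisometry V" using M by (simp add: shift_model_def)
  have "\<forall>x. T i s (T j t x) = lam i j s t *\<^sub>C T j t (T i s x)"
    if "i \<in> {1..k}" "j \<in> {1..k}" "i \<noteq> j" "s \<in> {1..n i}" "t \<in> {1..n j}" for i j s t
  proof -
    have bdd: "bounded_clinear (T i s)" "bounded_clinear (T j t)"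
      using T that by (auto simp: op_tuple_def)
    have lin: "clinear V" using V by (simp add: cisometry_def)
    \<comment> \<open>The relation for the adjoint shifts is pulled back through the injective
      \<open>V\<close>.\<close>
    have "V (cadjoint (T j t) (cadjoint (T i s) x))
        = V (cnj (lam i j s t) *\<^sub>C cadjoint (T i s) (cadjoint (T j t) x))" for x
      unfolding clinear_simps(3)[OF lin] shift_model_adjoint[OF M that(1,4)]
        shift_model_adjoint[OF M that(2,5)] by (rule shift_adj_commute[OF that])
    from injD[OF isometry_inj[OF V] this] show ?thesis
      unfolding cadjoint_commutation_iff[OF bdd] by blast
  qed
  moreover have "positive_op (defect r k n T)" if "0 \<le> r" "r < 1" for r
    unfolding positive_defect_iff[OF T]
  proof
    fix h
    have "defect_form r [1..<Suc k] n (\<lambda>i s. cadjoint (T i s)) norm_sq h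
        = defect_form r [1..<Suc k] n shift_adj (tuple_sq (\<lambda>_. 1)) (V h)"
    proof (rule defect_form_intertwine[where V = V])
      show "V (cadjoint (T i s) h) = shift_adj i s (V h)"
        if "i \<in> set [1..<Suc k]" "s \<in> {1..n i}" for i s h
        by (rule shift_model_adjoint[OF M]) (use that in auto)
    qed (rule shift_model_norm[OF M])
    also have "\<dots> = tuple_sq (\<lambda>\<alpha>. \<Prod>i\<in>set [1..<Suc k]. if \<alpha> i = [] then 1 else 1 - r\<^sup>2) (V h)"
      by (rule defect_form_tuple_sq) (use that in auto)
    also have "\<dots> \<ge> 0"
    proof (rule weighted_sq_nonneg, rule prod_nonneg)
      have "r\<^sup>2 \<le> 1" using that by (simp add: power_le_one)
      then show "0 \<le> (if \<alpha> i = [] then 1 else 1 - r\<^sup>2)" for \<alpha> :: "nat \<Rightarrow> nat list" and i by simp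
    qed
    finally show "0 \<le> defect_form r [1..<Suc k] n (\<lambda>i s. cadjoint (T i s)) norm_sq h" .
  qed
  ultimately show ?thesis
    using T shift_model_row_contraction[OF T M]
    unfolding regular_polyball_def commuting_row_contractions_def by blast
qed

text \<open>On \<open>V x\<close> the left compression is \<open>V\<close> applied to
  \<open>T\<^sub>i\<^sub>s* T\<^sub>j\<^sub>t x\<close>. Double commutation of the shifts turns the
  right one into \<open>V\<close> applied to the conjugate phase times
  \<open>T\<^sub>j\<^sub>t T\<^sub>i\<^sub>s* x\<close>. Injectivity of \<open>V\<close> does the
  rest.\<close>

lemma shift_model_doubly_commuting_iff:
  assumes T: "op_tuple k n T" and M: "shift_model k n lam T D V"
    and ij: "i \<in> {1..k}" "j \<in> {1..k}" "i \<noteq> j" "s \<in> {1..n i}" "t \<in> {1..n j}"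
  defines "P \<equiv> orth_proj (range V)"
  shows "(\<forall>f\<in>range V. P (shift_adj i s (P (shift_op j t f))) = P (shift_adj i s (shift_op j t f))) \<longleftrightarrow>
    (\<forall>x. cadjoint (T i s) (T j t x) = cnj (lam i j s t) *\<^sub>C T j t (cadjoint (T i s) x))"
proof -
  have V: "cisometry V" using M by (simp add: shift_model_def)
  have bdd: "bounded_clinear (T j t)" using T ij by (simp add: op_tuple_def)
  have S: "bounded_clinear (shift_op j t :: (nat \<Rightarrow> nat list, 'b) ell2 \<Rightarrow> _)"
    by (rule tensor_id_shift(1)[OF phases ij(2,5)])
  have P: "P f = V (cadjoint V f)" for f
    unfolding P_def by (rule orth_proj_range_isometry[OF V])
  \<comment> \<open>The adjoint form of the intertwining relation: \<open>T j t\<close> is the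
    compression of the shift.\<close>
  have compress: "cadjoint V (shift_op j t (V x)) = T j t x" for x
  proof (rule cinner_eqI)
    fix z
    have "cinner z (cadjoint V (shift_op j t (V x))) = cinner (shift_adj j t (V z)) (V x)"
      by (simp add: cinner_cadjoint[OF isometry_bounded[OF V], symmetric] cinner_cadjoint_right[OF S])
    also have "\<dots> = cinner (cadjoint (T j t) z) x"
      by (simp add: shift_model_adjoint[OF M ij(2,5), symmetric] isometry_cinner[OF V])
    also have "\<dots> = cinner z (T j t x)" by (rule cinner_cadjoint_right[OF bdd, symmetric])
    finally show "cinner z (cadjoint V (shift_op j t (V x))) = cinner z (T j t x)" .
  qed
  have "P (shift_adj i s (P (shift_op j t (V x)))) = V (cadjoint (T i s) (T j t x))" for x
    unfolding P compress shift_model_adjoint[OF M ij(1,4), symmetric] isometry_cadjoint[OF V] ..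
  moreover have "P (shift_adj i s (shift_op j t (V x)))
      = V (cnj (lam i j s t) *\<^sub>C T j t (cadjoint (T i s) x))" for x
    unfolding P shift_adj_shift_op[OF ij] shift_model_adjoint[OF M ij(1,4), symmetric]
      clinear_simps(3)[OF clinear_cadjoint[OF isometry_bounded[OF V]]] compress ..
  ultimately show ?thesis
    by (simp add: inj_eq[OF isometry_inj[OF V]])
qed

end

section \<open>The model of a pure element\<close>

text \<open>A partial geometric series, the truncated inverse of
  \<open>1 - form_map m B\<close>.\<close>

definition geom_form :: "nat \<Rightarrow> nat \<Rightarrow> (nat \<Rightarrow> 'a \<Rightarrow> 'a) \<Rightarrow> ('a \<Rightarrow> real) \<Rightarrow> 'a \<Rightarrow> real"
  where "geom_form l m B q x = (\<Sum>j<l. (form_map m B ^^ j) q x)"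

text \<open>On such forms the phases of the commutation relations disappear, so that the form maps
  of different rows commute.\<close>

definition phase_invariant :: "('a::chilbert_space \<Rightarrow> real) \<Rightarrow> bool"
  where "phase_invariant q \<longleftrightarrow> (\<forall>c x. cmod c = 1 \<longrightarrow> q (c *\<^sub>C x) = q x)"

text \<open>The strict length bound matches the \<open>l\<close> summands of
  \<open>geom_form l\<close>.\<close>

definition words :: "nat \<Rightarrow> nat \<Rightarrow> nat list set"
  where "words l m = {w \<in> lists {1..m}. length w < l}"

text \<open>Earlier positions and earlier letters act first. With adjoints for \<open>B\<close> and
  \<open>L = [1..<Suc k]\<close>, this is therefore the adjoint of the product of the operators in
  reading order.\<close>

definition tuple_act :: "(nat \<Rightarrow> nat \<Rightarrow> 'a \<Rightarrow> 'a) \<Rightarrow> nat list \<Rightarrow> (nat \<Rightarrow> nat list) \<Rightarrow> 'a \<Rightarrow> 'a"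
  where "tuple_act B L \<alpha> = fold (\<lambda>i. fold (B i) (\<alpha> i)) L"

section \<open>Geometric sums over words and their truncations\<close>

lemma form_map_funpow_diff:
  "(form_map m B ^^ l) (\<lambda>x. q x - q' x) x = (form_map m B ^^ l) q x - (form_map m B ^^ l) q' x"
proof (induction l arbitrary: x)
  case (Suc l)
  then show ?case by (simp add: Suc[abs_def] form_map_diff)
qed simp

lemma form_map_funpow_cmult:
  "(form_map m B ^^ l) (\<lambda>x. c * q x) x = c * (form_map m B ^^ l) q x"
proof (induction l arbitrary: x)
  case (Suc l)
  then show ?case by (simp add: Suc[abs_def] form_map_cmult)
qed simp

lemma form_map_funpow_mono:
  assumes "\<And>x. q x \<le> q' x"
  shows "(form_map m B ^^ l) q x \<le> (form_map m B ^^ l) q' x"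
  by (induction l arbitrary: x) (auto simp: assms form_map_mono)

lemma geom_form_telescope:
  "geom_form l m B (\<lambda>x. q x - form_map m B q x) x = q x - (form_map m B ^^ l) q x"
proof -
  have "geom_form l m B (\<lambda>x. q x - form_map m B q x) x
      = (\<Sum>j<l. (form_map m B ^^ j) q x - (form_map m B ^^ Suc j) q x)"
    unfolding geom_form_def form_map_funpow_diff funpow_Suc_right o_apply ..
  also have "\<dots> = q x - (form_map m B ^^ l) q x"
    by (subst sum_lessThan_telescope') simp
  finally show ?thesis .
qed

lemma geom_form_Suc: "geom_form (Suc l) m B q x = q x + form_map m B (geom_form l m B q) x"
  unfolding geom_form_def[abs_def] form_map_sum by (simp add: sum.lessThan_Suc_shift del: sum.lessThan_Suc)

lemma finite_words: "finite (words l m)"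
proof -
  have "words l m \<subseteq> {w. set w \<subseteq> {1..m} \<and> length w \<le> l}" by (auto simp: words_def)
  then show ?thesis using finite_lists_length_le[of "{1..m}" l] finite_subset by blast
qed

lemma words_Suc: "words (Suc l) m = insert [] ((\<lambda>(s, w). s # w) ` ({1..m} \<times> words l m))"
proof (intro set_eqI iffI)
  fix w assume "w \<in> words (Suc l) m"
  then show "w \<in> insert [] ((\<lambda>(s, w). s # w) ` ({1..m} \<times> words l m))"
    by (cases w) (auto simp: words_def)
qed (auto simp: words_def)

text \<open>Splitting off the first letter, which acts first, reproduces the recursion
  \<open>geom_form_Suc\<close>.\<close>

lemma sum_words: "(\<Sum>w\<in>words l m. q (fold B w x)) = geom_form l m B q x"
proof (induction l arbitrary: x)
  case 0
  then show ?case by (simp add: words_def geom_form_def)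
next
  case (Suc l)
  have "(\<Sum>w\<in>words (Suc l) m. q (fold B w x))
      = q x + (\<Sum>w\<in>(\<lambda>(s, w). s # w) ` ({1..m} \<times> words l m). q (fold B w x))"
    unfolding words_Suc by (subst sum.insert) (auto simp: finite_words)
  also have "(\<Sum>w\<in>(\<lambda>(s, w). s # w) ` ({1..m} \<times> words l m). q (fold B w x))
      = (\<Sum>p\<in>{1..m} \<times> words l m. q (fold B (snd p) (B (fst p) x)))"
    by (subst sum.reindex) (auto simp: inj_on_def split_def)
  also have "\<dots> = (\<Sum>s=1..m. \<Sum>w\<in>words l m. q (fold B w (B s x)))"
    by (simp add: sum.cartesian_product split_def)
  also have "\<dots> = form_map m B (geom_form l m B q) x"
    by (simp add: form_map_def Suc)
  finally show ?case by (simp add: geom_form_Suc)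
qed

lemma tuple_act_cong: "(\<And>i. i \<in> set L \<Longrightarrow> \<alpha> i = \<beta> i) \<Longrightarrow> tuple_act B L \<alpha> x = tuple_act B L \<beta> x"
  unfolding tuple_act_def by (induction L arbitrary: x) auto

text \<open>The sum over tuples is an iterated sum over words; the head of \<open>L\<close> acts
  first and so supplies the outermost geometric sum.\<close>

lemma sum_tuple_act:
  assumes "distinct L"
  shows "(\<Sum>\<alpha>\<in>(\<Pi>\<^sub>E i\<in>set L. words l (n i)). q (tuple_act B L \<alpha> x)) =
    foldr (\<lambda>i. geom_form l (n i) (B i)) L q x"
  using assms
proof (induction L arbitrary: x)
  case Nil
  then show ?case by (simp add: tuple_act_def)
next
  case (Cons i L)
  let ?P = "\<Pi>\<^sub>E i\<in>set L. words l (n i)"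
  have i: "i \<notin> set L" using Cons.prems by simp
  have "(\<Sum>\<alpha>\<in>(\<Pi>\<^sub>E i\<in>set (i # L). words l (n i)). q (tuple_act B (i # L) \<alpha> x))
      = (\<Sum>p\<in>words l (n i) \<times> ?P. q (tuple_act B (i # L) ((snd p)(i := fst p)) x))"
    unfolding list.set PiE_insert_eq
    by (subst sum.reindex[OF inj_combinator[OF i]]) (simp add: split_def)
  also have "\<dots> = (\<Sum>p\<in>words l (n i) \<times> ?P. q (tuple_act B L (snd p) (fold (B i) (fst p) x)))"
  proof (rule sum.cong[OF refl])
    fix p :: "nat list \<times> (nat \<Rightarrow> nat list)"
    have "tuple_act B L ((snd p)(i := fst p)) y = tuple_act B L (snd p) y" for y
      by (rule tuple_act_cong) (use i in auto)
    then show "q (tuple_act B (i # L) ((snd p)(i := fst p)) x)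
        = q (tuple_act B L (snd p) (fold (B i) (fst p) x))"
      by (simp add: tuple_act_def)
  qed
  also have "\<dots> = (\<Sum>w\<in>words l (n i). \<Sum>\<alpha>\<in>?P. q (tuple_act B L \<alpha> (fold (B i) w x)))"
    by (simp add: sum.cartesian_product split_def)
  also have "\<dots> = (\<Sum>w\<in>words l (n i). foldr (\<lambda>i. geom_form l (n i) (B i)) L q (fold (B i) w x))"
    using Cons by simp
  also have "\<dots> = foldr (\<lambda>i. geom_form l (n i) (B i)) (i # L) q x"
    by (simp add: sum_words)
  finally show ?case .
qed

text \<open>What is left of the defect after each factor has been telescoped up to
  \<open>l\<close>.\<close>

definition truncated_form ::
    "nat \<Rightarrow> nat list \<Rightarrow> (nat \<Rightarrow> nat) \<Rightarrow> (nat \<Rightarrow> nat \<Rightarrow> 'a \<Rightarrow> 'a) \<Rightarrow> ('a \<Rightarrow> real) \<Rightarrow> 'a \<Rightarrow> real"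
  where "truncated_form l L n B = foldr (\<lambda>i q x. q x - (form_map (n i) (B i) ^^ l) q x) L"

text \<open>Powers of the form map do not increase \<open>q\<close>, so each factor at most doubles
  the bound. Independence of \<open>l\<close> is the point: the limit below has \<open>l\<close> in
  all factors at once.\<close>

lemma truncated_form_bound:
  assumes "\<And>x. 0 \<le> q x" and "\<And>i x. i \<in> set L \<Longrightarrow> form_map (n i) (B i) q x \<le> q x"
  shows "\<bar>truncated_form l L n B q x\<bar> \<le> 2 ^ length L * q x"
  using assms(2)
proof (induction L arbitrary: x)
  case (Cons i L)
  define t where "t = truncated_form l L n B q"
  have t: "\<bar>t x\<bar> \<le> 2 ^ length L * q x" for x
    unfolding t_def by (rule Cons.IH) (use Cons.prems in simp)
  have "2 ^ length L * (form_map (n i) (B i) ^^ l) q x \<le> 2 ^ length L * q x"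
    by (intro mult_left_mono form_map_funpow_le) (use Cons.prems in simp_all)
  moreover have "(form_map (n i) (B i) ^^ l) t x \<le> 2 ^ length L * (form_map (n i) (B i) ^^ l) q x"
    unfolding form_map_funpow_cmult[symmetric]
    by (rule form_map_funpow_mono) (use t in \<open>simp add: abs_le_iff\<close>)
  moreover have "- (2 ^ length L) * (form_map (n i) (B i) ^^ l) q x \<le> (form_map (n i) (B i) ^^ l) t x"
    unfolding form_map_funpow_cmult[symmetric]
  proof (rule form_map_funpow_mono)
    show "- (2 ^ length L) * q x \<le> t x" for x
      using t[of x] by (simp add: abs_le_iff)
  qed
  ultimately have "\<bar>(form_map (n i) (B i) ^^ l) t x\<bar> \<le> 2 ^ length L * q x"
    by linarith
  then show ?case
    using t[of x] by (simp add: truncated_form_def t_def[unfolded truncated_form_def, symmetric])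
qed (simp add: truncated_form_def assms(1))

text \<open>In each factor the subtracted term is squeezed between multiples of
  \<open>(form_map (n i) (B i) ^^ l) q x\<close>, by applying the positive map to the uniform bound
  for the remaining factors.\<close>

lemma truncated_form_tendsto:
  assumes q: "\<And>x. 0 \<le> q x" and le: "\<And>i x. i \<in> set L \<Longrightarrow> form_map (n i) (B i) q x \<le> q x"
    and lim: "\<And>i. i \<in> set L \<Longrightarrow> (\<lambda>l. (form_map (n i) (B i) ^^ l) q x) \<longlonglongrightarrow> 0"
  shows "(\<lambda>l. truncated_form l L n B q x) \<longlonglongrightarrow> q x"
  using le lim
proof (induction L)
  case (Cons i L)
  let ?t = "\<lambda>l. truncated_form l L n B q"
  have IH: "(\<lambda>l. ?t l x) \<longlonglongrightarrow> q x"
    by (rule Cons.IH) (use Cons.prems in simp_all)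
  have t: "\<bar>?t l y\<bar> \<le> 2 ^ length L * q y" for l y
    by (rule truncated_form_bound[OF q]) (use Cons.prems in simp)
  have "(\<lambda>l. (form_map (n i) (B i) ^^ l) (?t l) x) \<longlonglongrightarrow> 0"
  proof (rule tendsto_sandwich)
    have "(\<lambda>l. c * (form_map (n i) (B i) ^^ l) q x) \<longlonglongrightarrow> c * 0" for c
      by (intro tendsto_mult_left Cons.prems) simp
    then show "(\<lambda>l. - (2 ^ length L) * (form_map (n i) (B i) ^^ l) q x) \<longlonglongrightarrow> 0"
      "(\<lambda>l. 2 ^ length L * (form_map (n i) (B i) ^^ l) q x) \<longlonglongrightarrow> 0"
      by (simp_all only: mult_zero_right)
    show "\<forall>\<^sub>F l in sequentially. - (2 ^ length L) * (form_map (n i) (B i) ^^ l) q x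
        \<le> (form_map (n i) (B i) ^^ l) (?t l) x"
      unfolding form_map_funpow_cmult[symmetric]
    proof (rule always_eventually, rule allI, rule form_map_funpow_mono)
      show "- (2 ^ length L) * q y \<le> ?t l y" for l y
        using t[of l y] by (simp add: abs_le_iff)
    qed
    show "\<forall>\<^sub>F l in sequentially. (form_map (n i) (B i) ^^ l) (?t l) x
        \<le> 2 ^ length L * (form_map (n i) (B i) ^^ l) q x"
      unfolding form_map_funpow_cmult[symmetric]
    proof (rule always_eventually, rule allI, rule form_map_funpow_mono)
      show "?t l y \<le> 2 ^ length L * q y" for l y
        using t[of l y] by (simp add: abs_le_iff)
    qed
  qed
  from tendsto_diff[OF IH this] show ?case
    by (simp add: truncated_form_def)
qed (simp add: truncated_form_def)

text \<open>\<open>B i s\<close> stands for the adjoint of \<open>T i s\<close>, whence the reversed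
  order and the conjugated phase.\<close>

locale commuting_adjoints = phases +
  fixes B :: "nat \<Rightarrow> nat \<Rightarrow> 'h::chilbert_space \<Rightarrow> 'h"
  assumes B_lin: "i \<in> {1..k} \<Longrightarrow> s \<in> {1..n i} \<Longrightarrow> clinear (B i s)"
    and B_comm: "\<lbrakk>i \<in> {1..k}; j \<in> {1..k}; i \<noteq> j; s \<in> {1..n i}; t \<in> {1..n j}\<rbrakk> \<Longrightarrow>
      B j t (B i s x) = cnj (lam i j s t) *\<^sub>C B i s (B j t x)"
begin

abbreviation fmap :: "nat \<Rightarrow> ('h \<Rightarrow> real) \<Rightarrow> 'h \<Rightarrow> real"
  where "fmap i \<equiv> form_map (n i) (B i)"

abbreviation gmap :: "nat \<Rightarrow> nat \<Rightarrow> ('h \<Rightarrow> real) \<Rightarrow> 'h \<Rightarrow> real"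
  where "gmap l i \<equiv> geom_form l (n i) (B i)"

lemma fmap_phase_invariant:
  assumes "phase_invariant q" "i \<in> {1..k}"
  shows "phase_invariant (fmap i q)"
  unfolding phase_invariant_def form_map_def
proof (intro allI impI sum.cong refl)
  fix c x s assume "cmod c = 1" "s \<in> {1..n i}"
  then show "q (B i s (c *\<^sub>C x)) = q (B i s x)"
    using assms by (simp add: clinear_simps(3)[OF B_lin] phase_invariant_def)
qed

lemma fmap_funpow_phase_invariant:
  assumes "phase_invariant q" "i \<in> {1..k}"
  shows "phase_invariant ((fmap i ^^ l) q)"
proof (induction l)
  case (Suc l)
  from fmap_phase_invariant[OF this assms(2)] show ?case by simp
qed (simp add: assms(1))

lemma gmap_phase_invariant:
  assumes "phase_invariant q" "i \<in> {1..k}"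
  shows "phase_invariant (gmap l i q)"
  using fmap_funpow_phase_invariant[OF assms]
  by (simp add: phase_invariant_def geom_form_def)

text \<open>Exchanging \<open>B i s\<close> and \<open>B j t\<close> costs a unimodular factor,
  which \<open>q\<close> ignores; then the two sums are swapped.\<close>

lemma fmap_commute:
  assumes "phase_invariant q" "i \<in> {1..k}" "j \<in> {1..k}"
  shows "fmap i (fmap j q) = fmap j (fmap i q)"
proof (cases "i = j")
  case False
  have "q (B j t (B i s x)) = q (B i s (B j t x))" if "s \<in> {1..n i}" "t \<in> {1..n j}" for s t x
    using assms(1) lam_unimodular(1)[OF assms(2,3) False that]
    by (simp add: B_comm[OF assms(2,3) False that] phase_invariant_def)
  then have "fmap i (fmap j q) x = (\<Sum>s=1..n i. \<Sum>t=1..n j. q (B i s (B j t x)))" for x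
    by (simp add: form_map_def)
  also have "(\<Sum>s=1..n i. \<Sum>t=1..n j. q (B i s (B j t x))) = fmap j (fmap i q) x" for x
    unfolding form_map_def by (rule sum.swap)
  finally show ?thesis by (rule ext)
qed simp

lemma fmap_funpow_commute:
  assumes "phase_invariant q" "i \<in> {1..k}" "j \<in> {1..k}"
  shows "(fmap j ^^ l) (fmap i q) = fmap i ((fmap j ^^ l) q)"
proof (induction l)
  case (Suc l)
  then show ?case
    using fmap_commute[OF fmap_funpow_phase_invariant[OF assms(1,3)] assms(2,3)] by simp
qed simp

lemma gmap_diff_commute:
  assumes "phase_invariant q" "i \<in> {1..k}" "j \<in> {1..k}"
  shows "gmap l j (\<lambda>x. q x - fmap i q x) = (\<lambda>x. gmap l j q x - fmap i (gmap l j q) x)"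
  unfolding geom_form_def[abs_def] form_map_funpow_diff fmap_funpow_commute[OF assms] form_map_sum
  by (simp add: sum_subtractf)

text \<open>Invariance is carried along because commuting the next geometric sum past
  \<open>fmap i\<close> requires it of the form built so far.\<close>

lemma foldr_gmap_diff_commute:
  assumes "phase_invariant q" "i \<in> {1..k}" "set L \<subseteq> {1..k}"
  shows "foldr (gmap l) L (\<lambda>x. q x - fmap i q x) =
      (\<lambda>x. foldr (gmap l) L q x - fmap i (foldr (gmap l) L q) x)
    \<and> phase_invariant (foldr (gmap l) L q)"
  using assms(3)
proof (induction L)
  case (Cons j L)
  then show ?case
    using gmap_diff_commute[OF _ assms(2), of "foldr (gmap l) L q" j l]
      gmap_phase_invariant[of "foldr (gmap l) L q" j l]
    by simp
qed (simp add: assms)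

lemma defect_form_phase_invariant:
  assumes "phase_invariant q" "set L \<subseteq> {1..k}"
  shows "phase_invariant (defect_form 1 L n B q)"
  using assms(2)
proof (induction L)
  case (Cons i L)
  then show ?case
    using fmap_phase_invariant[of "defect_form 1 L n B q" i] by (simp add: phase_invariant_def)
qed (simp add: assms)

text \<open>
  Each partial inverse \<open>gmap l i\<close> telescopes only against its own factor \<open>1 - fmap i\<close>, and the
  factors stand in the wrong order for that; they can be moved because the maps \<open>fmap i\<close> commute
  on forms that do not see the phases.
\<close>

lemma foldr_gmap_defect_form:
  assumes "phase_invariant q" "set L \<subseteq> {1..k}"
  shows "foldr (gmap l) L (defect_form 1 L n B q) = truncated_form l L n B q"
  using assms(2)
proof (induction L)
  case (Cons i L)
  define d where "d = defect_form 1 L n B q"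
  have d: "phase_invariant d" unfolding d_def
    by (rule defect_form_phase_invariant[OF assms(1)]) (use Cons.prems in simp)
  have "defect_form 1 (i # L) n B q = (\<lambda>x. d x - fmap i d x)"
    by (simp add: d_def fun_eq_iff)
  then have "foldr (gmap l) (i # L) (defect_form 1 (i # L) n B q)
      = gmap l i (foldr (gmap l) L (\<lambda>x. d x - fmap i d x))"
    by simp
  also have "\<dots> = gmap l i (\<lambda>x. foldr (gmap l) L d x - fmap i (foldr (gmap l) L d) x)"
    using foldr_gmap_diff_commute[OF d, of i L l] Cons.prems by simp
  also have "foldr (gmap l) L d = truncated_form l L n B q"
    unfolding d_def by (rule Cons.IH) (use Cons.prems in simp)
  finally show ?case
    unfolding geom_form_telescope[abs_def] by (simp add: truncated_form_def)
qed (simp add: truncated_form_def)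

lemma word_act_lin:
  assumes "i \<in> {1..k}" "w \<in> lists {1..n i}"
  shows "clinear (fold (B i) w)"
  using assms(2)
proof (induction w)
  case (Cons s w)
  then show ?case
    using B_lin[OF assms(1), of s] by (simp add: clinear_def)
qed (simp add: clinear_def)

lemma tuple_act_lin:
  assumes "set L \<subseteq> {1..k}" "\<And>i. i \<in> set L \<Longrightarrow> \<alpha> i \<in> lists {1..n i}"
  shows "clinear (tuple_act B L \<alpha>)"
  using assms
proof (induction L)
  case (Cons i L)
  have "clinear (fold (B i) (\<alpha> i))" by (rule word_act_lin) (use Cons.prems in simp_all)
  moreover have "clinear (tuple_act B L \<alpha>)" using Cons by simp
  ultimately show ?case by (simp add: clinear_def tuple_act_def)
qed (simp add: clinear_def tuple_act_def)

lemma word_act_exchange: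
  assumes "i \<in> {1..k}" "j \<in> {1..k}" "i \<noteq> j" "s \<in> {1..n i}" "w \<in> lists {1..n j}"
  shows "fold (B j) w (B i s x) = cnj (lam_word lam i j s w) *\<^sub>C B i s (fold (B j) w x)"
  using assms(5)
proof (induction w arbitrary: x)
  case (Cons t w)
  have "fold (B j) (t # w) (B i s x) = fold (B j) w (cnj (lam i j s t) *\<^sub>C B i s (B j t x))"
    using Cons.hyps B_comm[OF assms(1-4), of t] by simp
  also have "\<dots> = cnj (lam i j s t) *\<^sub>C fold (B j) w (B i s (B j t x))"
    by (rule clinear_simps(3)[OF word_act_lin[OF assms(2) Cons.hyps(2)]])
  finally show ?case
    by (simp add: Cons.IH lam_word_def scaleC_scaleC)
qed (simp add: lam_word_def)

lemma tuple_act_exchange: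
  assumes "\<alpha> \<in> tuples k n" "i \<in> {1..k}" "s \<in> {1..n i}" "l \<le> i"
  shows "tuple_act B [1..<l] \<alpha> (B i s x) =
    cnj (\<Prod>j\<in>{1..<l}. lam_word lam i j s (\<alpha> j)) *\<^sub>C B i s (tuple_act B [1..<l] \<alpha> x)"
  using assms(4)
proof (induction l)
  case (Suc l)
  \<comment> \<open>For \<open>l = 0\<close> both \<open>[1..<l]\<close> and
    \<open>[1..<Suc l]\<close> are empty, since positions start at 1.\<close>
  show ?case
  proof (cases "l = 0")
    case False
    then have l: "l \<in> {1..k}" "i \<noteq> l" "\<alpha> l \<in> lists {1..n l}"
      using Suc.prems assms(1,2) by (auto simp: tuples_def PiE_iff)
    have "tuple_act B [1..<Suc l] \<alpha> y = fold (B l) (\<alpha> l) (tuple_act B [1..<l] \<alpha> y)" for y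
      using False by (simp add: tuple_act_def)
    moreover have "(\<Prod>j\<in>{1..<Suc l}. lam_word lam i j s (\<alpha> j))
        = (\<Prod>j\<in>{1..<l}. lam_word lam i j s (\<alpha> j)) * lam_word lam i l s (\<alpha> l)"
      using False by (simp add: prod.atLeastLessThan_Suc)
    ultimately show ?thesis
      using Suc clinear_simps(3)[OF word_act_lin[OF l(1,3)]] word_act_exchange[OF assms(2) l(1,2) assms(3) l(3)]
      by (simp add: scaleC_scaleC del: upt_Suc)
  qed (simp add: tuple_act_def)
qed (simp add: tuple_act_def)

text \<open>To become the first letter of the \<open>i\<close>-th word, \<open>B i s\<close> only
  has to cross the words at positions before \<open>i\<close>. The phases collected on the way are
  exactly the conjugate of \<open>lam_coeff\<close>.\<close>

lemma tuple_act_push: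
  assumes "\<alpha> \<in> tuples k n" "i \<in> {1..k}" "s \<in> {1..n i}"
  shows "tuple_act B [1..<Suc k] \<alpha> (B i s x) =
    cnj (lam_coeff lam i s \<alpha>) *\<^sub>C tuple_act B [1..<Suc k] (\<alpha>(i := s # \<alpha> i)) x"
proof -
  have split: "[1..<Suc k] = [1..<i] @ i # [Suc i..<Suc k]"
    using assms(2) upt_add_eq_append[of 1 i "Suc k - i"] by (simp add: upt_conv_Cons del: upt_Suc)
  have act: "tuple_act B [1..<Suc k] \<beta> y =
      tuple_act B [Suc i..<Suc k] \<beta> (fold (B i) (\<beta> i) (tuple_act B [1..<i] \<beta> y))" for \<beta> y
    unfolding split by (simp add: tuple_act_def del: upt_Suc)
  define \<beta> where "\<beta> = \<alpha>(i := s # \<alpha> i)"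
  have \<alpha>: "\<alpha> j \<in> lists {1..n j}" if "j \<in> {1..k}" for j
    using assms(1) that by (auto simp: tuples_def PiE_iff)
  have lin: "clinear (tuple_act B [Suc i..<Suc k] \<alpha>)"
  proof (rule tuple_act_lin)
    show sub: "set [Suc i..<Suc k] \<subseteq> {1..k}" using assms(2) by auto
    show "\<alpha> j \<in> lists {1..n j}" if "j \<in> set [Suc i..<Suc k]" for j
      by (rule \<alpha>) (use sub that in blast)
  qed
  have cong: "tuple_act B [1..<i] \<beta> y = tuple_act B [1..<i] \<alpha> y"
    "tuple_act B [Suc i..<Suc k] \<beta> y = tuple_act B [Suc i..<Suc k] \<alpha> y" for y
    by (rule tuple_act_cong; auto simp: \<beta>_def simp del: upt_Suc)+
  have "tuple_act B [1..<Suc k] \<alpha> (B i s x) = tuple_act B [Suc i..<Suc k] \<alpha>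
      (fold (B i) (\<alpha> i) (cnj (lam_coeff lam i s \<alpha>) *\<^sub>C B i s (tuple_act B [1..<i] \<alpha> x)))"
    unfolding act lam_coeff_def using tuple_act_exchange[OF assms, of i] by simp
  also have "\<dots> = cnj (lam_coeff lam i s \<alpha>) *\<^sub>C tuple_act B [Suc i..<Suc k] \<alpha>
      (fold (B i) (\<alpha> i) (B i s (tuple_act B [1..<i] \<alpha> x)))"
    by (simp only: clinear_simps(3)[OF word_act_lin[OF assms(2) \<alpha>[OF assms(2)]]] clinear_simps(3)[OF lin])
  also have "\<dots> = cnj (lam_coeff lam i s \<alpha>) *\<^sub>C tuple_act B [1..<Suc k] \<beta> x"
    unfolding act cong by (simp add: \<beta>_def)
  finally show ?thesis by (simp only: \<beta>_def)
qed

text \<open>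
  The truncations of the sum run over words of length less than \<open>l\<close>; there the sum telescopes to
  \<open>truncated_form\<close>, which tends to the squared norm by purity.
\<close>

lemma has_sum_tuple_act:
  fixes d :: "'h \<Rightarrow> real"
  defines "d \<equiv> defect_form 1 [1..<Suc k] n B norm_sq"
  assumes row: "\<And>i x. i \<in> {1..k} \<Longrightarrow> fmap i norm_sq x \<le> norm_sq x"
    and pure: "\<And>i x. i \<in> {1..k} \<Longrightarrow> (\<lambda>l. (fmap i ^^ l) norm_sq x) \<longlonglongrightarrow> 0"
    and pos: "\<And>x. 0 \<le> d x"
  shows "((\<lambda>\<alpha>. d (tuple_act B [1..<Suc k] \<alpha> x)) has_sum norm_sq x) (tuples k n)"
proof -
  let ?L = "[1..<Suc k]"
  let ?g = "\<lambda>\<alpha>. d (tuple_act B ?L \<alpha> x)"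
  define F where "F l = (\<Pi>\<^sub>E i\<in>{1..k}. words l (n i))" for l
  have set: "set ?L = {1..k}" by auto
  have phase: "phase_invariant (norm_sq :: 'h \<Rightarrow> real)"
    by (simp add: phase_invariant_def norm_scaleC)
  have "sum ?g (F l) = truncated_form l ?L n B norm_sq x" for l
    unfolding F_def set[symmetric]
    using sum_tuple_act[where L = ?L and l = l and n = n and q = d and B = B and x = x] foldr_gmap_defect_form[OF phase, where L = ?L and l = l]
    by (simp add: d_def set del: upt_Suc set_upt One_nat_def)
  moreover have "(\<lambda>l. truncated_form l ?L n B norm_sq x) \<longlonglongrightarrow> norm_sq x"
    by (rule truncated_form_tendsto) (use row pure set in auto)
  ultimately have lim: "(\<lambda>l. sum ?g (F l)) \<longlonglongrightarrow> norm_sq x" by simp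
  have finite_F: "finite (F l)" for l
    unfolding F_def by (intro finite_PiE finite_words) simp
  have F_sub: "F l \<subseteq> tuples k n" for l
    unfolding F_def tuples_def by (rule PiE_mono) (auto simp: words_def)
  have F_mono: "F l \<subseteq> F l'" if "l \<le> l'" for l l'
    unfolding F_def by (rule PiE_mono) (use that in \<open>auto simp: words_def\<close>)
  have exhaust: "\<exists>l. A \<subseteq> F l" if "finite A" "A \<subseteq> tuples k n" for A
    using that
  proof (induction A rule: finite_induct)
    case (insert \<alpha> A)
    then obtain l where l: "A \<subseteq> F l" by auto
    \<comment> \<open>The extra 0 keeps the set nonempty for \<open>Max\<close>.\<close>
    define m where "m = Max ((\<lambda>i. length (\<alpha> i)) ` {1..k} \<union> {0})"
    have "length (\<alpha> i) < Suc m" if "i \<in> {1..k}" for i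
      unfolding m_def less_Suc_eq_le by (rule Max_ge) (use that in auto)
    then have "\<alpha> \<in> F (Suc m)"
      using insert.prems by (auto simp: F_def tuples_def words_def PiE_iff)
    then show ?case
      using l F_mono[of l "max l (Suc m)"] F_mono[of "Suc m" "max l (Suc m)"] by auto
  qed simp
  have le: "sum ?g A \<le> norm_sq x" if "finite A" "A \<subseteq> tuples k n" for A
  proof -
    have "\<exists>l. A \<subseteq> F l" by (rule exhaust[OF that])
    then obtain l where l: "A \<subseteq> F l" by blast
    \<comment> \<open>Terms are nonnegative and the sets \<open>F\<close> increase, so every finite
      sum lies below the limit in \<open>lim\<close>.\<close>
    have "sum ?g A \<le> sum ?g (F l')" if "l \<le> l'" for l'
      by (rule sum_mono2[OF finite_F]) (use l F_mono[OF that] pos in auto)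
    then show ?thesis
      by (intro LIMSEQ_le_const[OF lim]) blast
  qed
  have summable: "?g summable_on tuples k n"
    by (rule nonneg_bdd_above_summable_on) (auto intro!: bdd_aboveI2[where M = "norm_sq x"] pos le
        simp del: upt_Suc One_nat_def)
  moreover have "infsum ?g (tuples k n) = norm_sq x"
  proof (rule antisym)
    show "infsum ?g (tuples k n) \<le> norm_sq x"
      by (rule infsum_le_finite_sums[OF summable]) (rule le)
    have "sum ?g (F l) \<le> infsum ?g (tuples k n)" for l
      by (rule finite_sum_le_infsum[OF summable finite_F F_sub]) (rule pos)
    then show "norm_sq x \<le> infsum ?g (tuples k n)"
      by (intro LIMSEQ_le_const2[OF lim]) blast
  qed
  ultimately show ?thesis using has_sum_infsum by metis
qed

end

section \<open>Construction of the model map\<close>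

context phases
begin

text \<open>The coefficient space is the original Hilbert space, because the square root
  \<open>W\<close> of the defect maps it into itself.\<close>

lemma pure_polyball_model:
  fixes T :: "nat \<Rightarrow> nat \<Rightarrow> 'h::chilbert_space \<Rightarrow> 'h"
  assumes T: "op_tuple k n T" and pure: "pure_tuple k n T" and ball: "T \<in> regular_polyball k n lam"
  shows "\<exists>V. shift_model k n lam T (UNIV :: 'h set) V"
proof -
  let ?L = "[1..<Suc k]"
  define B where "B i s = cadjoint (T i s)" for i s
  have bdd: "bounded_clinear (T i s)" if "i \<in> {1..k}" "s \<in> {1..n i}" for i s
    using T that by (simp add: op_tuple_def)
  have comm: "\<forall>x. T i s (T j t x) = lam i j s t *\<^sub>C T j t (T i s x)"
    if "i \<in> {1..k}" "j \<in> {1..k}" "i \<noteq> j" "s \<in> {1..n i}" "t \<in> {1..n j}" for i j s t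
    using ball that unfolding regular_polyball_def commuting_row_contractions_def by blast
  interpret commuting_adjoints k n lam B
  proof
    show "clinear (B i s)" if "i \<in> {1..k}" "s \<in> {1..n i}" for i s
      unfolding B_def by (rule clinear_cadjoint[OF bdd[OF that]])
    show "B j t (B i s x) = cnj (lam i j s t) *\<^sub>C B i s (B j t x)"
      if "i \<in> {1..k}" "j \<in> {1..k}" "i \<noteq> j" "s \<in> {1..n i}" "t \<in> {1..n j}" for i j s t x
      using comm[OF that] cadjoint_commutation_iff[OF bdd[OF that(1,4)] bdd[OF that(2,5)]]
      by (simp add: B_def)
  qed
  have rows: "\<forall>i\<in>{1..k}. row_contraction (n i) (T i)"
    using ball unfolding regular_polyball_def commuting_row_contractions_def by blast
  define d :: "'h \<Rightarrow> real" where "d = defect_form 1 ?L n B norm_sq"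
  have d_nonneg: "0 \<le> d x" for x
    unfolding d_def
  proof (rule defect_form_one_nonneg)
    fix r :: real assume "0 \<le> r" "r < 1"
    then have "positive_op (defect r k n T)" using ball by (simp add: regular_polyball_def)
    then show "0 \<le> defect_form r ?L n B norm_sq x"
      unfolding positive_defect_iff[OF T] B_def[abs_def] by blast
  qed
  have sum: "((\<lambda>\<alpha>. d (tuple_act B ?L \<alpha> x)) has_sum norm_sq x) (tuples k n)" for x
    unfolding d_def
  proof (rule has_sum_tuple_act)
    show "fmap i norm_sq x \<le> norm_sq x" if "i \<in> {1..k}" for i x
      using row_contraction_iff[of "n i" "T i"] rows bdd that by (simp add: B_def[abs_def])
    show "(\<lambda>l. (fmap i ^^ l) norm_sq x) \<longlonglongrightarrow> 0" if "i \<in> {1..k}" for i x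
      using pure pure_tuple_iff[OF T rows] that by (simp add: B_def[abs_def])
  qed (rule d_nonneg[unfolded d_def])
  \<comment> \<open>The tuple \<open>e\<close> of empty words contributes the single term
    \<open>d x\<close> to a nonnegative sum with value \<open>norm_sq x\<close>. This is the upper
    bound needed for the square root.\<close>
  have d_le: "d x \<le> norm_sq x" for x
  proof -
    define e where "e = (\<lambda>i\<in>{1..k}. [] :: nat list)"
    have act: "tuple_act B L e y = y" if "set L \<subseteq> {1..k}" for L y
      using that unfolding tuple_act_def by (induction L arbitrary: y) (auto simp: e_def)
    have id: "tuple_act B ?L e x = x" by (rule act) auto
    have "e \<in> tuples k n" by (auto simp: e_def tuples_def)
    then have "sum (\<lambda>\<alpha>. d (tuple_act B ?L \<alpha> x)) {e} \<le> norm_sq x"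
      using has_sum_imp_summable[OF sum[of x]] infsumI[OF sum[of x]] d_nonneg
      by (metis (no_types, lifting) empty_subsetI finite.emptyI finite_insert finite_sum_le_infsum
          insert_subset)
    then show ?thesis by (simp add: id del: upt_Suc One_nat_def)
  qed
  \<comment> \<open>The defect operator at \<open>r = 1\<close>, obtained as the limit case of the
    regular polyball condition.\<close>
  define Y where "Y = foldr (\<lambda>i Y x. Y x - Phi 1 (n i) (T i) Y x) ?L id"
  have "\<forall>i\<in>set ?L. \<forall>s\<in>{1..n i}. bounded_clinear (T i s)" using bdd by auto
  note Y = defect_fold[OF this, of 1, folded Y_def]
  have ReY: "Re (cinner (Y x) x) = d x" for x
    unfolding Y(3) d_def B_def[abs_def] by simp
  obtain W :: "'h \<Rightarrow> 'h" where W: "clinear W" "\<And>x. (norm (W x))\<^sup>2 = d x"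
    using positive_contraction_sqrt[OF Y(1,2)] d_nonneg d_le unfolding ReY by blast
  define V where "V h = Abs_ell2 (\<lambda>\<alpha>. if \<alpha> \<in> tuples k n then W (tuple_act B ?L \<alpha> h) else 0)" for h
  \<comment> \<open>One identity serves twice: it puts the family in \<open>ell2\<close> and makes
    \<open>V\<close> isometric.\<close>
  have norms: "((\<lambda>\<alpha>. (norm (if \<alpha> \<in> tuples k n then W (tuple_act B ?L \<alpha> h) else 0))\<^sup>2)
      has_sum norm_sq h) UNIV" for h
    using sum[of h] by (subst has_sum_cong_neutral[where g = "\<lambda>\<alpha>. d (tuple_act B ?L \<alpha> h)"
          and T = "tuples k n"]) (auto simp: W(2))
  have nth: "ell2_nth (V h) \<alpha> = (if \<alpha> \<in> tuples k n then W (tuple_act B ?L \<alpha> h) else 0)" for h \<alpha>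
    unfolding V_def by (subst Abs_ell2_inverse) (use has_sum_imp_summable[OF norms] in auto)
  have act_lin: "clinear (tuple_act B ?L \<alpha>)" if "\<alpha> \<in> tuples k n" for \<alpha>
    by (rule tuple_act_lin) (use that in \<open>auto simp: tuples_def PiE_iff\<close>)
  have V: "cisometry V"
    unfolding cisometry_def
  proof (intro conjI allI)
    show "clinear V"
      unfolding clinear_def
      by (auto intro!: ell2_eqI simp: nth clinear_simps[OF act_lin] clinear_simps[OF W(1)]
          simp del: upt_Suc One_nat_def)
    fix h
    have "norm_sq (V h) = norm_sq h"
      unfolding ell2_norm_sq nth by (rule infsumI[OF norms])
    then show "norm (V h) = norm h" by simp
  qed
  have intertwine: "V (cadjoint (T i s) h) = shift_adj i s (V h)"
    if "i \<in> {1..k}" "s \<in> {1..n i}" for i s h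
  proof (rule ell2_eqI)
    fix \<alpha> :: "nat \<Rightarrow> nat list"
    show "ell2_nth (V (cadjoint (T i s) h)) \<alpha> = ell2_nth (shift_adj i s (V h)) \<alpha>"
      using tuple_act_push[where \<alpha> = \<alpha> and x = h, OF _ that]
        tuples_push[where \<alpha> = \<alpha> and k = k and n = n, OF _ that]
      by (simp add: nth ell2_nth_shift_adj[OF that] B_def clinear_simps(3)[OF W(1)]
          del: upt_Suc One_nat_def)
  qed
  have "shift_model k n lam T (UNIV :: 'h set) V"
    unfolding shift_model_def
  proof (intro conjI ballI allI)
    show "range V \<subseteq> ell2_on (tuples k n) UNIV" by (auto simp: ell2_on_def nth)
    show "shift_adj i s f \<in> range V" if "i \<in> {1..k}" "s \<in> {1..n i}" "f \<in> range V" for i s f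
      using intertwine[OF that(1,2), symmetric] that(3) by auto
  qed (use V intertwine in auto)
  then show ?thesis by blast
qed

end

text \<open>Types cannot be quantified over, so the existence half places \<open>D\<close> in the
  space of \<open>T\<close> itself, as the construction does. The second half covers coefficient
  spaces of every type \<open>'d\<close>, and thereby the converse implication for each of
  them.\<close>

theorem theorem4p6:
  fixes k :: nat and n :: "nat \<Rightarrow> nat"
    and lam :: "nat \<Rightarrow> nat \<Rightarrow> nat \<Rightarrow> nat \<Rightarrow> complex"
    and T :: "nat \<Rightarrow> nat \<Rightarrow> 'h::chilbert_space \<Rightarrow> 'h"
  assumes "1 \<le> k" and "\<forall>i\<in>{1..k}. 1 \<le> n i"
    and "phase_matrices k n lam"
    and "op_tuple k n T"
  shows "(pure_tuple k n T \<and> T \<in> regular_polyball k n lam \<longleftrightarrow>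
      (\<exists>(D :: 'h set) V. closed_csubspace D \<and> shift_model k n lam T D V))
    \<and> (\<forall>(D :: 'd::chilbert_space set) V. closed_csubspace D \<and> shift_model k n lam T D V \<longrightarrow>
      pure_tuple k n T \<and> T \<in> regular_polyball k n lam
      \<and> (T \<in> doubly_commuting_row_contractions k n lam \<longleftrightarrow>
          (\<forall>i\<in>{1..k}. \<forall>j\<in>{1..k}. i \<noteq> j \<longrightarrow> (\<forall>s\<in>{1..n i}. \<forall>t\<in>{1..n j}.
            let P = orth_proj (range V);
                Si = tensor_id (shift k n lam i s);
                Sj = tensor_id (shift k n lam j t)
            in \<forall>f\<in>range V. P (cadjoint Si (P (Sj f))) = P (cadjoint Si (Sj f))))))"
proof -
  interpret phases k n lam by unfold_locales fact
  note T = \<open>op_tuple k n T\<close>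
  have model: "\<exists>(D :: 'h set) V. closed_csubspace D \<and> shift_model k n lam T D V"
    if "pure_tuple k n T \<and> T \<in> regular_polyball k n lam"
  proof -
    have "closed_csubspace (UNIV :: 'h set)" by (simp add: closed_csubspace_def)
    moreover have "\<exists>V. shift_model k n lam T (UNIV :: 'h set) V"
      using pure_polyball_model[OF T] that by simp
    ultimately show ?thesis by auto
  qed
  show ?thesis
  proof (intro conjI[OF iffI] allI impI conjI)
    fix D :: "'d set" and V
    assume "closed_csubspace D \<and> shift_model k n lam T D V"
    then have M: "shift_model k n lam T D V" by (rule conjunct2)
    show "pure_tuple k n T" by (rule shift_model_pure[OF T M])
    show ball: "T \<in> regular_polyball k n lam" by (rule shift_model_polyball[OF T M])
    then have "T \<in> commuting_row_contractions k n lam" by (simp add: regular_polyball_def)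
    then have "T \<in> doubly_commuting_row_contractions k n lam \<longleftrightarrow>
        (\<forall>i\<in>{1..k}. \<forall>j\<in>{1..k}. i \<noteq> j \<longrightarrow> (\<forall>s\<in>{1..n i}. \<forall>t\<in>{1..n j}. \<forall>x.
          cadjoint (T i s) (T j t x) = cnj (lam i j s t) *\<^sub>C T j t (cadjoint (T i s) x)))"
      unfolding doubly_commuting_row_contractions_def by simp
    also have "\<dots> \<longleftrightarrow> (\<forall>i\<in>{1..k}. \<forall>j\<in>{1..k}. i \<noteq> j \<longrightarrow> (\<forall>s\<in>{1..n i}. \<forall>t\<in>{1..n j}.
        \<forall>f\<in>range V. orth_proj (range V) (shift_adj i s (orth_proj (range V) (shift_op j t f)))
          = orth_proj (range V) (shift_adj i s (shift_op j t f))))"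
      by (intro ball_cong refl imp_cong shift_model_doubly_commuting_iff[OF T M, symmetric])
    finally show "T \<in> doubly_commuting_row_contractions k n lam \<longleftrightarrow>
        (\<forall>i\<in>{1..k}. \<forall>j\<in>{1..k}. i \<noteq> j \<longrightarrow> (\<forall>s\<in>{1..n i}. \<forall>t\<in>{1..n j}.
          let P = orth_proj (range V);
              Si = tensor_id (shift k n lam i s);
              Sj = tensor_id (shift k n lam j t)
          in \<forall>f\<in>range V. P (cadjoint Si (P (Sj f))) = P (cadjoint Si (Sj f))))"
      unfolding Let_def .
  next
    assume "pure_tuple k n T \<and> T \<in> regular_polyball k n lam"
    then show "\<exists>(D :: 'h set) V. closed_csubspace D \<and> shift_model k n lam T D V" by (rule model)
  next
    assume "\<exists>(D :: 'h set) V. closed_csubspace D \<and> shift_model k n lam T D V"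
    then obtain D :: "'h set" and V where M: "shift_model k n lam T D V" by auto
    show "pure_tuple k n T" by (rule shift_model_pure[OF T M])
    show "T \<in> regular_polyball k n lam" by (rule shift_model_polyball[OF T M])
  qed
qed

end
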